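(* Let $p$ be a prime, $h\ge1$, $q=p^{2h}$, and let $a_1,\dots,a_h$ be an $\mathbb{F}_p$-basis of $A=\{a\in\mathbb{F}_q: a^{p^h}+a=0\}$. Let $1\le t\le h$ and let $$B=\{(x,y_1,\dots,y_t)\in\mathbb{F}_q^{t+1}:\ y_i^p-y_i=a_ix^{p^h+1}\ \text{for all } i\in[t]\},$$ ordered as $Q_1,\dots,Q_n$. Let $l=q-tp^h+2tp^{h-1}-t$, $$V=\operatorname{Span}_{\mathbb{F}_q}\{x^jy_1^{e_1}\cdots y_t^{e_t}:\ 0\le j\le l,\ 0\le e_i\le p-2\},$$ and $C=\{(f(Q_1),\dots,f(Q_n)):f\in V\}$. Then $C$ is a linear $[n,k,d]$ code over $\mathbb{F}_q$ with availability $t$ and locality $(p-1,\dots,p-1)$ (the $j$-th recovery set of the position of $(\alpha,\beta_1,\dots,\beta_t)$ consisting of the other points of $B$ with $x=\alpha$ and $y_k=\beta_k$ for all $k\ne j$), where $$n=p^tq,\qquad k=(q-tp^h+2tp^{h-1}-t+1)(p-1)^t,\qquad d\ge 2tp^{t-1}.$$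
   Context: This is the code $C(l\infty_x,B)$ on the fiber product over $\mathbb{P}^1_x$ of the Artin–Schreier curves $\mathcal{Y}_{a_i}: y^p-y=a_ix^{p^h+1}$, $i\in[t]$, with $B$ the affine $\mathbb{F}_q$-rational points. A linear code of length $n$ has availability $t$ and locality $(r_1,\dots,r_t)$ if each position $i$ has pairwise disjoint sets $A_{i1},\dots,A_{it}\subseteq[n]\setminus\{i\}$ with $|A_{ij}|=r_j$ such that the $i$-th entry of every codeword is a function of its entries on $A_{ij}$, for each $j$. *)

theory Defs
  imports
    Complex_Main
    "HOL-Library.FuncSet"
    "HOL-Library.Disjoint_Sets"
    "HOL-Library.Cardinality"
    "HOL-Library.Function_Algebras"
    "HOL-Computational_Algebra.Primes"
begin

definition fun_scale :: "'a::field \<Rightarrow> ('b \<Rightarrow> 'a) \<Rightarrow> 'b \<Rightarrow> 'a" where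
  "fun_scale c f = (\<lambda>x. c * f x)"

global_interpretation fun_vs: vector_space "fun_scale :: 'a::field \<Rightarrow> ('b \<Rightarrow> 'a) \<Rightarrow> 'b \<Rightarrow> 'a"
  by standard (simp_all add: fun_scale_def fun_eq_iff algebra_simps)

text \<open>The image of the integers is a copy of the field with $p$ elements whenever the
  characteristic is the prime $p$.\<close>

definition prime_subfield :: "'a::field set" where
  "prime_subfield = range of_int"

definition basis_over :: "'a::field set \<Rightarrow> 'a set \<Rightarrow> 'i set \<Rightarrow> ('i \<Rightarrow> 'a) \<Rightarrow> bool" where
  "basis_over K S I a \<longleftrightarrow>
     S = {\<Sum>i\<in>I. c i * a i | c. c \<in> I \<rightarrow> K} \<and>
     (\<forall>c \<in> I \<rightarrow> K. (\<Sum>i\<in>I. c i * a i) = 0 \<longrightarrow> (\<forall>i\<in>I. c i = 0))"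

text \<open>A point $(x, y_1, \dots, y_t)$ is a pair of $x$ and a function on $\{1,\dots,t\}$;
  extensionality makes this representation unique.\<close>

type_synonym 'a point = "'a \<times> (nat \<Rightarrow> 'a)"

definition affine_points :: "nat \<Rightarrow> nat \<Rightarrow> nat \<Rightarrow> (nat \<Rightarrow> 'a::field) \<Rightarrow> 'a point set" where
  "affine_points p h t a =
     {(x, y). y \<in> {1..t} \<rightarrow>\<^sub>E UNIV \<and> (\<forall>i\<in>{1..t}. y i ^ p - y i = a i * x ^ (p ^ h + 1))}"

definition monomial :: "nat \<Rightarrow> nat \<Rightarrow> (nat \<Rightarrow> nat) \<Rightarrow> 'a::field point \<Rightarrow> 'a" where
  "monomial t j e = (\<lambda>(x, y). x ^ j * (\<Prod>i\<in>{1..t}. y i ^ e i))"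

definition eval_space :: "nat \<Rightarrow> nat \<Rightarrow> int \<Rightarrow> ('a::field point \<Rightarrow> 'a) set" where
  "eval_space p t l =
     fun_vs.span {monomial t j e | j e. int j \<le> l \<and> (\<forall>i\<in>{1..t}. e i \<le> p - 2)}"

text \<open>Words of length $n$ are functions on the naturals that vanish outside $\{1,\dots,n\}$,
  so that the pointwise operations on functions are those of the $n$-dimensional space.\<close>

definition words :: "nat \<Rightarrow> (nat \<Rightarrow> 'a::zero) set" where
  "words n = {w. \<forall>i. i \<notin> {1..n} \<longrightarrow> w i = 0}"

definition evaluation :: "nat \<Rightarrow> (nat \<Rightarrow> 'b) \<Rightarrow> ('b \<Rightarrow> 'a::zero) \<Rightarrow> nat \<Rightarrow> 'a" where
  "evaluation n Q f = (\<lambda>i. if i \<in> {1..n} then f (Q i) else 0)"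

definition linear_code :: "nat \<Rightarrow> (nat \<Rightarrow> 'a::field) set \<Rightarrow> bool" where
  "linear_code n C \<longleftrightarrow> C \<subseteq> words n \<and> fun_vs.subspace C"

definition hamming_dist :: "nat \<Rightarrow> (nat \<Rightarrow> 'a) \<Rightarrow> (nat \<Rightarrow> 'a) \<Rightarrow> nat" where
  "hamming_dist n u v = card {i \<in> {1..n}. u i \<noteq> v i}"

text \<open>For a code with at most one word this is the infimum of the empty set, which is $0$ in
  the naturals.\<close>

definition min_distance :: "nat \<Rightarrow> (nat \<Rightarrow> 'a) set \<Rightarrow> nat" where
  "min_distance n C = Inf {hamming_dist n u v | u v. u \<in> C \<and> v \<in> C \<and> u \<noteq> v}"

definition recovers :: "(nat \<Rightarrow> 'a) set \<Rightarrow> nat \<Rightarrow> nat set \<Rightarrow> bool" where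
  "recovers C i S \<longleftrightarrow> (\<exists>\<phi> :: (nat \<Rightarrow> 'a) \<Rightarrow> 'a. \<forall>c\<in>C. c i = \<phi> (restrict c S))"

definition recovery_system ::
    "nat \<Rightarrow> (nat \<Rightarrow> 'a) set \<Rightarrow> nat \<Rightarrow> (nat \<Rightarrow> nat) \<Rightarrow> (nat \<Rightarrow> nat \<Rightarrow> nat set) \<Rightarrow> bool" where
  "recovery_system n C t r R \<longleftrightarrow>
     (\<forall>i\<in>{1..n}. disjoint_family_on (R i) {1..t} \<and>
        (\<forall>j\<in>{1..t}. R i j \<subseteq> {1..n} - {i} \<and> card (R i j) = r j \<and> recovers C i (R i j)))"

definition has_availability_locality ::
    "nat \<Rightarrow> (nat \<Rightarrow> 'a) set \<Rightarrow> nat \<Rightarrow> (nat \<Rightarrow> nat) \<Rightarrow> bool" where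
  "has_availability_locality n C t r \<longleftrightarrow> (\<exists>R. recovery_system n C t r R)"

definition fiber_recovery_set ::
    "nat \<Rightarrow> nat \<Rightarrow> (nat \<Rightarrow> 'a point) \<Rightarrow> nat \<Rightarrow> nat \<Rightarrow> nat set" where
  "fiber_recovery_set n t Q i j =
     {m \<in> {1..n} - {i}. fst (Q m) = fst (Q i) \<and>
        (\<forall>k \<in> {1..t} - {j}. snd (Q m) k = snd (Q i) k)}"

end

theory Submission
  imports Defs "HOL-Computational_Algebra.Polynomial" "HOL-Library.Indicator_Function"
begin

text \<open>
  The bound on the minimum distance needs an upper bound for the number of zeros of a function on
  the curve.  Instead of divisors we use an \<^emph>\<open>order basis\<close>: a family of functions with formal pole
  orders, at most one for each order, such that the product of the members of orders \<open>r\<close> and \<open>s\<close>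
  is a nonzero multiple of the member of order \<open>r + s\<close> up to terms of lower order.  Let \<open>S\<close> be
  the semigroup of orders.  If \<open>F\<close> has order \<open>w\<close> and vanishes on \<open>Z\<close>, then multiples of \<open>F\<close>
  eliminate all orders in \<open>w + S\<close> on \<open>Z\<close>, so the functions on \<open>Z\<close> are spanned by the members with
  orders in \<open>S - (w + S)\<close>.  These orders are distinct modulo \<open>w\<close>, hence \<open>|Z| \<le> w\<close>.

  The powers of \<open>x\<close> form an order basis.  Let \<open>X\<close> be a member of order \<open>m\<close>, prime to \<open>p\<close>, and let
  \<open>y\<^sub>i\<^sup>p - y\<^sub>i = a\<^sub>i X\<close> with \<open>a\<^sub>i = b\<^sub>i\<^sup>p\<close> independent over the prime field.  Then \<open>z = y\<^sub>1 / b\<^sub>1\<close>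
  satisfies \<open>z\<^sup>p = X + \<gamma> z\<close>, so it can be adjoined with order \<open>m\<close> after multiplying all orders
  by \<open>p\<close>.  The functions \<open>y\<^sub>i - b\<^sub>i z\<close> for \<open>i \<ge> 2\<close> satisfy equations of the same shape with \<open>z\<close> in
  place of \<open>X\<close> and the coefficients \<open>b\<^sub>i - \<gamma> b\<^sub>i\<^sup>p\<close>, which are again independent.  After \<open>t\<close>
  steps \<open>x\<close> has order \<open>p\<^sup>t\<close> and every \<open>y\<^sub>i\<close> has order at most \<open>p\<^bsup>t-1\<^esup> m\<close>.

  Since \<open>a\<^sub>i x\<^sup>m\<close> has trace zero for \<open>m = p\<^sup>h + 1\<close>, there are \<open>p\<^sup>t\<close> points above every \<open>x\<close>;
  recovery is interpolation of a polynomial of degree at most \<open>p - 2\<close> in one coordinate.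
\<close>

section \<open>Finite fields and the Artin--Schreier map\<close>

lemma finite_field_power_card:
  fixes x :: "'a::{field,finite}"
  shows "x ^ CARD('a) = x"
proof (cases "x = 0")
  case False
  have "(\<Prod>y\<in>UNIV - {0}. y) = (\<Prod>y\<in>UNIV - {0}. x * y)"
    by (rule prod.reindex_bij_witness[of _ "\<lambda>y. x * y" "\<lambda>y. y / x"]) (use False in auto)
  also have "\<dots> = x ^ (CARD('a) - 1) * (\<Prod>y\<in>UNIV - {0}. y)"
    by (simp add: prod.distrib card_Diff_singleton)
  finally have "x ^ (CARD('a) - 1) = 1" by simp
  then show ?thesis using power_minus_mult[of "CARD('a)" x] by simp
qed simp

lemma CHAR_eq_of_card_eq_prime_power:
  assumes "prime p" "CARD('a::{field,finite}) = p ^ n"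
  shows "CHAR('a) = p"
proof -
  have "(\<Sum>x\<in>UNIV. x) = (\<Sum>x\<in>UNIV. x + 1 :: 'a)"
    by (rule sum.reindex_bij_witness[of _ "\<lambda>x. x + 1" "\<lambda>x. x - 1"]) auto
  then have "(of_nat (CARD('a)) :: 'a) = 0" by (simp add: sum.distrib)
  then have "(of_nat p :: 'a) = 0" using assms(2) by simp
  then have "CHAR('a) dvd p" by (simp add: of_nat_eq_0_iff_char_dvd)
  then show ?thesis using assms(1) CHAR_not_1'[where 'a = 'a] by (auto simp: prime_nat_iff)
qed

lemma frobenius_diff:
  fixes x y :: "'a::field"
  assumes "prime p" "CHAR('a) = p"
  shows "(x - y) ^ (p ^ n) = x ^ (p ^ n) - y ^ (p ^ n)"
proof -
  have "(x - y + y) ^ (p ^ n) = (x - y) ^ (p ^ n) + y ^ (p ^ n)"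
    by (rule freshmans_dream') (use assms in auto)
  then show ?thesis by (simp add: algebra_simps)
qed

lemma surj_frobenius:
  assumes "prime p" "CARD('a::{field,finite}) = p ^ n"
  shows "surj (\<lambda>z::'a. z ^ p)"
proof -
  have "inj (\<lambda>z::'a. z ^ p)"
  proof (rule injI)
    fix x y :: 'a assume "x ^ p = y ^ p"
    then have "(x - y) ^ p = 0"
      using frobenius_diff[OF assms(1) CHAR_eq_of_card_eq_prime_power[OF assms], of x y 1] by simp
    then show "x = y" by simp
  qed
  then show ?thesis by (simp add: finite_UNIV_inj_surj)
qed

lemma of_int_in_prime_subfield [simp]: "of_int k \<in> prime_subfield"
  by (simp add: prime_subfield_def)

lemma zero_one_in_prime_subfield [simp]: "0 \<in> prime_subfield" "1 \<in> prime_subfield"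
  using of_int_in_prime_subfield[of 0] of_int_in_prime_subfield[of 1] by simp_all

lemma uminus_in_prime_subfield: "z \<in> prime_subfield \<Longrightarrow> - z \<in> prime_subfield"
  by (auto simp: prime_subfield_def simp flip: of_int_minus)

lemma prime_subfield_eq_image_of_nat:
  assumes "prime p" "CHAR('a::field) = p"
  shows "(prime_subfield :: 'a set) = of_nat ` {..<p}"
proof (intro subset_antisym subsetI)
  fix z :: 'a assume "z \<in> prime_subfield"
  then obtain k where "z = of_int k" by (auto simp: prime_subfield_def)
  have "int p dvd k - k mod int p" by (simp add: minus_mod_eq_mult_div)
  then have "of_int (k - k mod int p) = (0 :: 'a)"
    using assms(2) by (simp only: of_int_eq_0_iff_char_dvd)
  moreover have "k mod int p = int (nat (k mod int p))" "nat (k mod int p) < p"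
    using assms(1) by (simp_all add: prime_gt_0_nat nat_less_iff)
  ultimately show "z \<in> of_nat ` {..<p}"
    using \<open>z = of_int k\<close>
    by (metis image_eqI lessThan_iff of_int_diff of_int_of_nat_eq right_minus_eq)
qed (auto simp: prime_subfield_def intro: range_eqI[of _ _ "int _"])

lemma card_prime_subfield:
  assumes "prime p" "CHAR('a::field) = p"
  shows "card (prime_subfield :: 'a set) = p"
proof -
  have "inj_on (of_nat :: nat \<Rightarrow> 'a) {..<p}"
  proof (rule linorder_inj_onI)
    fix x y assume "x < y" "x \<in> {..<p}" "y \<in> {..<p}"
    then have "\<not> p dvd y - x" by (auto dest: dvd_imp_le)
    then show "(of_nat x :: 'a) \<noteq> of_nat y"
      using of_nat_eq_iff_char_dvd[OF \<open>x < y\<close>, where 'a = 'a] assms(2) by simp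
  qed auto
  then show ?thesis by (simp add: prime_subfield_eq_image_of_nat[OF assms] card_image)
qed

lemma prime_subfield_eq_frobenius_fixed_points:
  assumes "prime p" "CHAR('a::field) = p"
  shows "(prime_subfield :: 'a set) = {z. z ^ p = z}"
proof (rule card_seteq)
  have "p > 1" using assms(1) by (rule prime_gt_1_nat)
  define P :: "'a poly" where "P = monom 1 p - monom 1 1"
  have "degree P = p"
    using degree_add_eq_left[of "- monom 1 1" "monom (1::'a) p"] \<open>p > 1\<close>
    by (simp add: P_def degree_monom_eq)
  then have "P \<noteq> 0" using \<open>p > 1\<close> by auto
  have roots: "{z. z ^ p = z} = {z. poly P z = 0}" by (auto simp: P_def poly_monom)
  show "finite {z :: 'a. z ^ p = z}" unfolding roots using \<open>P \<noteq> 0\<close> by (rule poly_roots_finite)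
  show "card {z :: 'a. z ^ p = z} \<le> card (prime_subfield :: 'a set)"
    unfolding roots card_prime_subfield[OF assms]
    using card_poly_roots_bound[OF \<open>P \<noteq> 0\<close>] \<open>degree P = p\<close> by simp
  have "(of_nat n :: 'a) ^ p = of_nat n" for n
  proof (induction n)
    case (Suc n)
    have "(1 + of_nat n :: 'a) ^ p = 1 ^ p + of_nat n ^ p"
      by (rule freshmans_dream) (use assms in auto)
    then show ?case using Suc by simp
  qed (use \<open>p > 1\<close> in simp)
  then show "(prime_subfield :: 'a set) \<subseteq> {z. z ^ p = z}"
    unfolding prime_subfield_eq_image_of_nat[OF assms] by auto
qed

lemma card_artin_schreier_fiber:
  assumes "prime p" "CHAR('a::field) = p"
  shows "card {y :: 'a. y ^ p - y = x ^ p - x} = p"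
proof -
  have "(y - x) ^ p - (y - x) = (y ^ p - y) - (x ^ p - x)" for y
    using frobenius_diff[OF assms, of y x 1] by simp
  then have "y ^ p - y = x ^ p - x \<longleftrightarrow> (y - x) ^ p = y - x" for y
    by (simp only: eq_iff_diff_eq_0[of "y ^ p - y"] eq_iff_diff_eq_0[of "(y - x) ^ p"])
  then have "{y. y ^ p - y = x ^ p - x} = (\<lambda>y. y - x) -` prime_subfield"
    unfolding prime_subfield_eq_frobenius_fixed_points[OF assms] by blast
  moreover have "surj (\<lambda>y. y - x)" by (rule surjI[of _ "\<lambda>y. y + x"]) simp
  ultimately show ?thesis
    using card_vimage_inj[of "\<lambda>y. y - x" prime_subfield] card_prime_subfield[OF assms]
    by (simp add: inj_on_def)
qed

lemma card_range_artin_schreier: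
  assumes "prime p" "CARD('a::{field,finite}) = p ^ Suc n"
  shows "card (range (\<lambda>y :: 'a. y ^ p - y)) = p ^ n"
proof -
  let ?f = "\<lambda>y :: 'a. y ^ p - y"
  have "CARD('a) = (\<Sum>c\<in>range ?f. card {x \<in> UNIV. ?f x = c})"
    using sum.image_gen[of UNIV "\<lambda>_. 1::nat" ?f] by simp
  also have "\<dots> = (\<Sum>c\<in>range ?f. p)"
    using card_artin_schreier_fiber[OF assms(1) CHAR_eq_of_card_eq_prime_power[OF assms]]
    by (intro sum.cong) auto
  finally show ?thesis using assms by (simp add: prime_gt_0_nat)
qed

lemma range_artin_schreier_eq_trace_kernel:
  assumes "prime p" "CARD('a::{field,finite}) = p ^ Suc n"
  shows "range (\<lambda>y :: 'a. y ^ p - y) = {z. (\<Sum>i\<le>n. z ^ (p ^ i)) = 0}"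
proof (rule card_seteq)
  note char = CHAR_eq_of_card_eq_prime_power[OF assms]
  have "p > 1" using assms(1) by (rule prime_gt_1_nat)
  show "range (\<lambda>y :: 'a. y ^ p - y) \<subseteq> {z. (\<Sum>i\<le>n. z ^ (p ^ i)) = 0}"
  proof clarify
    fix y :: 'a
    have "(\<Sum>i\<le>n. (y ^ p - y) ^ (p ^ i)) = (\<Sum>i<Suc n. y ^ (p ^ Suc i) - y ^ (p ^ i))"
      by (simp add: frobenius_diff[OF assms(1) char] lessThan_Suc_atMost flip: power_mult)
    also have "\<dots> = y ^ (p ^ Suc n) - y ^ (p ^ 0)" by (rule sum_lessThan_telescope)
    also have "\<dots> = 0" using finite_field_power_card[of y] assms(2) by simp
    finally show "(\<Sum>i\<le>n. (y ^ p - y) ^ (p ^ i)) = 0" .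
  qed
  define P :: "'a poly" where "P = (\<Sum>i\<le>n. monom 1 (p ^ i))"
  have "coeff P (p ^ n) = (\<Sum>i\<le>n. if i = n then 1 else 0)"
    unfolding P_def coeff_sum using \<open>p > 1\<close> by (intro sum.cong) (auto simp: power_inject_exp)
  then have "P \<noteq> 0" by auto
  have "degree P \<le> p ^ n"
    unfolding P_def using \<open>p > 1\<close>
    by (intro degree_sum_le) (auto simp: degree_monom_eq intro: power_increasing)
  moreover have "{z. (\<Sum>i\<le>n. z ^ (p ^ i)) = 0} = {z. poly P z = 0}"
    by (simp add: P_def poly_sum poly_monom)
  ultimately show "card {z :: 'a. (\<Sum>i\<le>n. z ^ (p ^ i)) = 0} \<le> card (range (\<lambda>y :: 'a. y ^ p - y))"
    using card_poly_roots_bound[OF \<open>P \<noteq> 0\<close>] card_range_artin_schreier[OF assms] by simp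
qed simp

lemma trace_eq_0_if_frobenius_eq_uminus:
  fixes b :: "'a::field"
  assumes "prime p" "CHAR('a) = p" "b ^ (p ^ h) = - b"
  shows "(\<Sum>i<2 * h. b ^ (p ^ i)) = 0"
proof -
  have "b ^ (p ^ (h + i)) = - (b ^ (p ^ i))" for i
  proof -
    have "b ^ (p ^ (h + i)) = (0 - b) ^ (p ^ i)" using assms(3) by (simp add: power_add power_mult)
    also have "\<dots> = - (b ^ (p ^ i))"
      unfolding frobenius_diff[OF assms(1,2)] using assms(1)
      by (simp add: power_0_left prime_gt_0_nat)
    finally show ?thesis .
  qed
  moreover have "(\<Sum>i<h + h. f i) = (\<Sum>i<h. f i) + (\<Sum>i<h. f (h + i))" for f :: "nat \<Rightarrow> 'a"
    using sum.atLeastLessThan_concat[of 0 h "h + h" f] sum.shift_bounds_nat_ivl[of f 0 h h]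
    by (simp add: atLeast0LessThan add.commute)
  ultimately show ?thesis by (simp add: mult_2 sum_negf)
qed

lemma card_artin_schreier_fiber_norm:
  fixes a x :: "'a::{field,finite}"
  assumes "prime p" "h \<ge> 1" "CARD('a) = p ^ (2 * h)" and "a ^ (p ^ h) + a = 0"
  shows "card {y. y ^ p - y = a * x ^ (p ^ h + 1)} = p"
proof -
  note char = CHAR_eq_of_card_eq_prime_power[OF assms(1,3)]
  define b where "b = a * x ^ (p ^ h + 1)"
  have "x ^ (p ^ (2 * h)) = x" using finite_field_power_card[of x] assms(3) by simp
  moreover have "b ^ (p ^ h) = a ^ (p ^ h) * (x ^ (p ^ (2 * h)) * x ^ (p ^ h))"
    by (simp add: b_def power_mult_distrib power_add power_commutes mult_2 flip: power_mult)
  moreover have "a ^ (p ^ h) = - a" using assms(4) by (simp add: eq_neg_iff_add_eq_0)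
  ultimately have "b ^ (p ^ h) = - b" by (simp add: b_def)
  then have "(\<Sum>i<2 * h. b ^ (p ^ i)) = 0"
    by (rule trace_eq_0_if_frobenius_eq_uminus[OF assms(1) char])
  moreover obtain n where double_h: "2 * h = Suc n" using assms(2) by (cases "2 * h") auto
  ultimately have "b \<in> range (\<lambda>y. y ^ p - y)"
    unfolding range_artin_schreier_eq_trace_kernel[OF assms(1) assms(3)[unfolded double_h]]
    by (simp add: double_h lessThan_Suc_atMost)
  then obtain y where "b = y ^ p - y" by blast
  then show ?thesis
    using card_artin_schreier_fiber[OF assms(1) char, of y] by (simp add: b_def)
qed

section \<open>Linear independence over the prime field\<close>

definition lin_indep_over :: "'a::field set \<Rightarrow> 'i set \<Rightarrow> ('i \<Rightarrow> 'a) \<Rightarrow> bool" where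
  "lin_indep_over K I a \<longleftrightarrow> (\<forall>c \<in> I \<rightarrow> K. (\<Sum>i\<in>I. c i * a i) = 0 \<longrightarrow> (\<forall>i\<in>I. c i = 0))"

lemma lin_indep_overI:
  assumes "\<And>c i. c \<in> I \<rightarrow> K \<Longrightarrow> (\<Sum>i\<in>I. c i * a i) = 0 \<Longrightarrow> i \<in> I \<Longrightarrow> c i = 0"
  shows "lin_indep_over K I a"
  using assms unfolding lin_indep_over_def by blast

lemma lin_indep_overD:
  assumes "lin_indep_over K I a" "c \<in> I \<rightarrow> K" "(\<Sum>i\<in>I. c i * a i) = 0" "i \<in> I"
  shows "c i = 0"
  using assms unfolding lin_indep_over_def by blast

lemma lin_indep_over_subset:
  assumes "lin_indep_over K I a" "finite I" "J \<subseteq> I" "0 \<in> K"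
  shows "lin_indep_over K J a"
proof (rule lin_indep_overI)
  fix c j assume coeffs: "c \<in> J \<rightarrow> K" and relation: "(\<Sum>i\<in>J. c i * a i) = 0" and "j \<in> J"
  define c' where "c' i = (if i \<in> J then c i else 0)" for i
  have "(\<Sum>i\<in>I. c' i * a i) = (\<Sum>i\<in>J. c i * a i)"
    using assms(2,3) by (intro sum.mono_neutral_cong_right) (auto simp: c'_def)
  moreover have "c' \<in> I \<rightarrow> K" using coeffs assms(4) by (auto simp: c'_def)
  ultimately have "c' j = 0"
    using lin_indep_overD[OF assms(1), of c' j] relation \<open>j \<in> J\<close> assms(3) by auto
  then show "c j = 0" using \<open>j \<in> J\<close> by (simp add: c'_def)
qed

lemma lin_indep_over_nonzero:
  assumes "lin_indep_over K I a" "finite I" "i \<in> I" "0 \<in> K" "1 \<in> K"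
  shows "a i \<noteq> 0"
proof
  assume "a i = 0"
  have "lin_indep_over K {i} a" using lin_indep_over_subset[OF assms(1,2)] assms(3,4) by simp
  from lin_indep_overD[OF this, of "\<lambda>_. 1" i] show False using \<open>a i = 0\<close> assms(5) by simp
qed

lemma basis_over_imp_mem:
  fixes a :: "'i \<Rightarrow> 'a::field"
  assumes "basis_over K S I a" "finite I" "i \<in> I" "0 \<in> K" "1 \<in> K"
  shows "a i \<in> S"
proof -
  define c :: "'i \<Rightarrow> 'a" where "c k = (if k = i then 1 else 0)" for k
  have "(\<Sum>k\<in>I. c k * a k) = (\<Sum>k\<in>I. if k = i then a i else 0)"
    unfolding c_def by (intro sum.cong) auto
  then have "a i = (\<Sum>k\<in>I. c k * a k)" using assms(2,3) by simp
  moreover have "c \<in> I \<rightarrow> K" using assms(4,5) by (simp add: c_def)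
  ultimately show ?thesis using assms(1) unfolding basis_over_def by blast
qed

lemma basis_over_imp_lin_indep_over: "basis_over K S I a \<Longrightarrow> lin_indep_over K I a"
  by (simp add: basis_over_def lin_indep_over_def)

text \<open>
  The map \<open>u \<mapsto> u - \<gamma> u\<^sup>p\<close> with \<open>\<gamma> = b\<^sub>k / b\<^sub>k\<^sup>p\<close> is linear over the prime field, and its kernel
  consists of the prime field multiples of \<open>b\<^sub>k\<close>.
\<close>

lemma lin_indep_over_frobenius_twist:
  fixes b :: "'i \<Rightarrow> 'a::field"
  assumes "prime p" "CHAR('a) = p" "finite I" "k \<notin> I"
    and indep: "lin_indep_over prime_subfield (insert k I) (\<lambda>i. b i ^ p)"
  shows "lin_indep_over prime_subfield I (\<lambda>i. b i - b k / b k ^ p * b i ^ p)"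
proof (rule lin_indep_overI)
  fix c i
  assume coeffs: "c \<in> I \<rightarrow> prime_subfield" and "i \<in> I"
    and relation: "(\<Sum>i\<in>I. c i * (b i - b k / b k ^ p * b i ^ p)) = 0"
  have fixed: "z \<in> prime_subfield \<longleftrightarrow> z ^ p = z" for z :: 'a
    using prime_subfield_eq_frobenius_fixed_points[OF assms(1,2)] by blast
  have "b k \<noteq> 0"
    using lin_indep_over_nonzero[OF indep, of k] assms(1,3) by (auto simp: prime_gt_0_nat)
  define u where "u = (\<Sum>i\<in>I. c i * b i)"
  have "u ^ p = (\<Sum>i\<in>I. (c i * b i) ^ p)"
    unfolding u_def using assms(1,2) by (intro freshmans_dream_sum) auto
  also have "\<dots> = (\<Sum>i\<in>I. c i * b i ^ p)"
    using coeffs by (intro sum.cong refl) (simp add: power_mult_distrib fixed Pi_iff)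
  finally have frobenius_u: "u ^ p = (\<Sum>i\<in>I. c i * b i ^ p)" .
  have "u - b k / b k ^ p * u ^ p = 0"
    using relation unfolding frobenius_u
    by (simp add: u_def right_diff_distrib sum_subtractf sum_distrib_left mult.left_commute)
  then have quotient: "(u / b k) ^ p = u / b k"
    using \<open>b k \<noteq> 0\<close> by (simp add: power_divide field_simps)
  define c' where "c' = c(k := - (u / b k))"
  have "(\<Sum>i\<in>I. c' i * b i ^ p) = u ^ p"
    unfolding frobenius_u c'_def using assms(4) by (intro sum.cong) auto
  also have "u ^ p = u / b k * b k ^ p"
    using quotient \<open>b k \<noteq> 0\<close> by (simp add: power_divide field_simps)
  finally have "(\<Sum>i\<in>insert k I. c' i * b i ^ p) = 0" using assms(3,4) by (simp add: c'_def)
  moreover have "c' \<in> insert k I \<rightarrow> prime_subfield"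
    using coeffs uminus_in_prime_subfield[of "u / b k"] quotient by (auto simp: c'_def fixed)
  ultimately have "c' i = 0" using lin_indep_overD[OF indep] \<open>i \<in> I\<close> by blast
  then show "c i = 0" using \<open>i \<in> I\<close> assms(4) by (auto simp: c'_def split: if_splits)
qed

section \<open>Spaces of functions\<close>

lemma sum_fun_apply: "(\<Sum>i\<in>I. f i) x = (\<Sum>i\<in>I. f i x)"
  for f :: "'i \<Rightarrow> 'b \<Rightarrow> 'a::comm_monoid_add"
  by (induction I rule: infinite_finite_induct) simp_all

lemma prod_fun_apply: "(\<Prod>i\<in>I. f i) x = (\<Prod>i\<in>I. f i x)"
  for f :: "'i \<Rightarrow> 'b \<Rightarrow> 'a::comm_monoid_mult"
  by (induction I rule: infinite_finite_induct) simp_all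

lemma power_fun_apply: "(f ^ n) x = f x ^ n" for f :: "'b \<Rightarrow> 'a::monoid_mult"
  by (induction n) simp_all

lemma (in vector_space) independent_family:
  assumes "finite J" and indep: "\<And>c. (\<Sum>u\<in>J. c u *s g u) = 0 \<Longrightarrow> \<forall>u\<in>J. c u = 0"
  shows "inj_on g J" "independent (g ` J)"
proof -
  show inj: "inj_on g J"
  proof (rule inj_onI, rule ccontr)
    fix u v assume collision: "u \<in> J" "v \<in> J" "g u = g v" "u \<noteq> v"
    define c :: "'c \<Rightarrow> 'a" where "c = (\<lambda>w. if w = u then 1 else if w = v then - 1 else 0)"
    have "(\<Sum>w\<in>J. c w *s g w) = (\<Sum>w\<in>{u, v}. c w *s g w)"
      using assms(1) collision by (intro sum.mono_neutral_right) (auto simp: c_def)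
    also have "\<dots> = 0" using collision by (simp add: c_def)
    finally have "c u = 0" using indep collision(1) by blast
    then show False by (simp add: c_def)
  qed
  show "independent (g ` J)"
  proof (rule independent_if_scalars_zero)
    fix c v assume "(\<Sum>v\<in>g ` J. c v *s v) = 0" "v \<in> g ` J"
    then show "c v = 0" using indep[of "c \<circ> g"] by (auto simp: sum.reindex[OF inj])
  qed (use assms(1) in simp)
qed

lemma subspace_times_preimage:
  assumes "fun_vs.subspace S"
  shows "fun_vs.subspace {f. f * g \<in> S}"
proof (rule fun_vs.subspaceI)
  fix c f assume "f \<in> {f. f * g \<in> S}"
  moreover have "fun_scale c f * g = fun_scale c (f * g)"
    by (simp add: fun_scale_def fun_eq_iff mult.assoc)
  ultimately show "fun_scale c f \<in> {f. f * g \<in> S}"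
    using fun_vs.subspace_scale[OF assms] by simp
qed (use assms in \<open>simp_all add: distrib_right fun_vs.subspace_0 fun_vs.subspace_add\<close>)

definition vanishing_on :: "'b set \<Rightarrow> ('b \<Rightarrow> 'a::zero) set" where
  "vanishing_on B = {f. \<forall>b\<in>B. f b = 0}"

lemma subspace_vanishing_on: "fun_vs.subspace (vanishing_on B)"
  by (rule fun_vs.subspaceI) (auto simp: vanishing_on_def fun_scale_def)

lemma vanishing_on_times: "f \<in> vanishing_on B \<Longrightarrow> f * g \<in> vanishing_on B"
  for f g :: "'b \<Rightarrow> 'a::mult_zero"
  by (simp add: vanishing_on_def)

lemma vanishing_on_antimono: "Z \<subseteq> B \<Longrightarrow> vanishing_on B \<subseteq> vanishing_on Z"
  by (auto simp: vanishing_on_def)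

lemma independent_point_indicators:
  assumes "finite Z"
  shows "inj_on (\<lambda>P. indicator {P} :: 'b \<Rightarrow> 'a::field) Z"
    and "\<not> fun_vs.dependent ((\<lambda>P. indicator {P} :: 'b \<Rightarrow> 'a::field) ` Z)"
proof -
  have "\<forall>P\<in>Z. c P = 0"
    if relation: "(\<Sum>P\<in>Z. fun_scale (c P) (indicator {P})) = (0 :: 'b \<Rightarrow> 'a)" for c
  proof
    fix R assume "R \<in> Z"
    then have "(\<Sum>P\<in>Z. fun_scale (c P) (indicator {P})) R = c R"
      using assms by (simp add: sum_fun_apply fun_scale_def indicator_def if_distrib cong: if_cong)
    then show "c R = 0" using relation by simp
  qed
  note independent = fun_vs.independent_family[OF assms this]
  show "inj_on (\<lambda>P. indicator {P} :: 'b \<Rightarrow> 'a) Z" by (rule independent(1))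
  show "\<not> fun_vs.dependent ((\<lambda>P. indicator {P} :: 'b \<Rightarrow> 'a) ` Z)" by (rule independent(2))
qed

lemma times_indicator_in_span:
  assumes "f \<in> fun_vs.span (T \<union> vanishing_on Z)"
  shows "f * indicator Z \<in> fun_vs.span ((\<lambda>f. f * indicator Z) ` T)" (is "_ \<in> ?U")
proof -
  have "fun_vs.span (T \<union> vanishing_on Z) \<subseteq> {f. f * indicator Z \<in> ?U}"
  proof (rule fun_vs.span_minimal)
    show "fun_vs.subspace {f. f * indicator Z \<in> ?U}" by (intro subspace_times_preimage) simp
    have "g * indicator Z = 0" if "g \<in> vanishing_on Z" for g :: "'a \<Rightarrow> 'b"
      using that by (auto simp: vanishing_on_def indicator_def fun_eq_iff)
    then show "T \<union> vanishing_on Z \<subseteq> {f. f * indicator Z \<in> ?U}"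
      by (auto intro: fun_vs.span_base simp: fun_vs.span_zero)
  qed
  then show ?thesis using assms by blast
qed

lemma card_le_if_spans_functions:
  fixes T :: "('b \<Rightarrow> 'a::field) set"
  assumes "finite Z" "finite T"
    and span: "\<And>g. \<exists>f \<in> fun_vs.span (T \<union> vanishing_on Z). \<forall>P\<in>Z. f P = g P"
  shows "card Z \<le> card T"
proof -
  let ?\<delta> = "\<lambda>P. indicator {P} :: 'b \<Rightarrow> 'a" and ?cut = "\<lambda>f :: 'b \<Rightarrow> 'a. f * indicator Z"
  have delta_span: "?\<delta> ` Z \<subseteq> fun_vs.span (?cut ` T)"
  proof clarify
    fix P assume "P \<in> Z"
    obtain f where f_span: "f \<in> fun_vs.span (T \<union> vanishing_on Z)" and "\<forall>R\<in>Z. f R = ?\<delta> P R"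
      using span by blast
    then have "?cut f = ?\<delta> P" using \<open>P \<in> Z\<close> by (auto simp: indicator_def fun_eq_iff)
    then show "?\<delta> P \<in> fun_vs.span (?cut ` T)" using times_indicator_in_span[OF f_span] by simp
  qed
  have "card Z = card (?\<delta> ` Z)"
    by (rule card_image[OF independent_point_indicators(1)[OF assms(1)], symmetric])
  also have "\<dots> \<le> card (?cut ` T)"
    using assms(2) fun_vs.independent_span_bound[OF _ independent_point_indicators(2) delta_span]
      assms(1) by blast
  also have "\<dots> \<le> card T" using assms(2) by (rule card_image_le)
  finally show ?thesis .
qed

lemma separating_subalgebra_contains_bump:
  fixes A :: "('b \<Rightarrow> 'a::field) set"
  assumes "fun_vs.subspace A" "1 \<in> A" "\<And>f g. f \<in> A \<Longrightarrow> g \<in> A \<Longrightarrow> f * g \<in> A"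
    and "finite Y" and separates: "\<And>R. R \<in> Y \<Longrightarrow> \<exists>f\<in>A. f P \<noteq> f R"
  shows "\<exists>f\<in>A. f P = 1 \<and> (\<forall>R\<in>Y. f R = 0)"
  using assms(4) separates
proof (induction Y rule: finite_induct)
  case empty
  then show ?case using assms(2) by (intro bexI[of _ 1]) auto
next
  case (insert R Y)
  then obtain f where bump: "f \<in> A" "f P = 1" "\<forall>R\<in>Y. f R = 0" by auto
  obtain g where separating: "g \<in> A" "g P \<noteq> g R" using insert.prems by blast
  define k where "k = fun_scale (inverse (g P - g R)) (g - fun_scale (g R) 1)"
  have "k \<in> A"
    unfolding k_def using assms(1,2) separating(1)
    by (intro fun_vs.subspace_scale fun_vs.subspace_diff)
  moreover have "k P = 1" "k R = 0" using separating(2) by (simp_all add: k_def fun_scale_def)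
  ultimately show ?case using bump assms(3) by (intro bexI[of _ "f * k"]) auto
qed

lemma separating_subalgebra_interpolates:
  fixes A :: "('b \<Rightarrow> 'a::field) set"
  assumes subalgebra: "fun_vs.subspace A" "1 \<in> A" "\<And>f g. f \<in> A \<Longrightarrow> g \<in> A \<Longrightarrow> f * g \<in> A"
    and "finite Z" and separates: "\<And>P R. P \<in> Z \<Longrightarrow> R \<in> Z \<Longrightarrow> P \<noteq> R \<Longrightarrow> \<exists>f\<in>A. f P \<noteq> f R"
  shows "\<exists>f\<in>A. \<forall>P\<in>Z. f P = g P"
proof -
  have "\<exists>f\<in>A. f P = 1 \<and> (\<forall>R\<in>Z - {P}. f R = 0)" if "P \<in> Z" for P
    using that assms(4) separates by (intro separating_subalgebra_contains_bump[OF subalgebra]) auto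
  then obtain \<delta> where bump: "\<And>P. P \<in> Z \<Longrightarrow> \<delta> P \<in> A \<and> \<delta> P P = 1 \<and> (\<forall>R\<in>Z - {P}. \<delta> P R = 0)"
    by metis
  show ?thesis
  proof (intro bexI ballI)
    show "(\<Sum>P\<in>Z. fun_scale (g P) (\<delta> P)) \<in> A"
      using subalgebra(1) bump by (intro fun_vs.subspace_sum fun_vs.subspace_scale) auto
    fix R assume "R \<in> Z"
    then have "(\<Sum>P\<in>Z. fun_scale (g P) (\<delta> P)) R = (\<Sum>P\<in>Z. if P = R then g R else 0)"
      unfolding sum_fun_apply fun_scale_def using bump by (intro sum.cong) auto
    then show "(\<Sum>P\<in>Z. fun_scale (g P) (\<delta> P)) R = g R" using \<open>R \<in> Z\<close> assms(4) by simp
  qed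
qed

section \<open>Order bases\<close>

text \<open>
  A pair \<open>(n, f) \<in> G\<close> declares the function \<open>f\<close> to have order \<open>n\<close>.  Functions that agree on \<open>B\<close> are
  not distinguished, and order at most \<open>n\<close> is expressed as \<open>order_less B G (Suc n)\<close>.
\<close>

definition order_less :: "'b set \<Rightarrow> (nat \<times> ('b \<Rightarrow> 'a::field)) set \<Rightarrow> nat \<Rightarrow> ('b \<Rightarrow> 'a) set" where
  "order_less B G n = fun_vs.span ({f. \<exists>s<n. (s, f) \<in> G} \<union> vanishing_on B)"

lemma subspace_order_less [iff]: "fun_vs.subspace (order_less B G n)"
  by (simp add: order_less_def)

lemma zero_in_order_less [simp]: "0 \<in> order_less B G n"
  using subspace_order_less by (rule fun_vs.subspace_0)

lemmas order_less_add = fun_vs.subspace_add[OF subspace_order_less]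
  and order_less_scale = fun_vs.subspace_scale[OF subspace_order_less]

lemma order_less_mono: "m \<le> n \<Longrightarrow> order_less B G m \<subseteq> order_less B G n"
  unfolding order_less_def
  by (intro fun_vs.span_mono Un_mono Collect_mono) (auto intro: less_le_trans)

lemma order_less_add_scale:
  assumes "f \<in> order_less B G m" "g \<in> order_less B G n" "m \<le> n"
  shows "f + fun_scale c g \<in> order_less B G n"
  using assms order_less_mono[of m n B G] by (intro order_less_add order_less_scale) auto

lemma order_lessI: "(s, f) \<in> G \<Longrightarrow> s < n \<Longrightarrow> f \<in> order_less B G n"
  unfolding order_less_def by (rule fun_vs.span_base) blast

lemma vanishing_on_subset_order_less: "vanishing_on B \<subseteq> order_less B G n"
  unfolding order_less_def by (rule order_trans[OF _ fun_vs.span_superset]) blast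

lemma order_less_0: "order_less B G 0 = vanishing_on B"
  using fun_vs.span_eq_iff[of "vanishing_on B"] subspace_vanishing_on[of B]
  by (simp add: order_less_def)

lemma order_less_induct:
  assumes "f \<in> order_less B G n" "fun_vs.subspace S" "vanishing_on B \<subseteq> S"
    and "\<And>s g. (s, g) \<in> G \<Longrightarrow> s < n \<Longrightarrow> g \<in> S"
  shows "f \<in> S"
proof -
  have "order_less B G n \<subseteq> S"
    unfolding order_less_def by (rule fun_vs.span_minimal) (use assms in auto)
  then show ?thesis using assms(1) by blast
qed

definition has_order :: "'b set \<Rightarrow> (nat \<times> ('b \<Rightarrow> 'a::field)) set \<Rightarrow> nat \<Rightarrow> ('b \<Rightarrow> 'a) \<Rightarrow> bool" where
  "has_order B G n f \<longleftrightarrow>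
     (\<exists>g c. (n, g) \<in> G \<and> c \<noteq> 0 \<and> f - fun_scale c g \<in> order_less B G n)"

lemma has_orderI:
  "(n, g) \<in> G \<Longrightarrow> c \<noteq> 0 \<Longrightarrow> f - fun_scale c g \<in> order_less B G n \<Longrightarrow> has_order B G n f"
  by (auto simp: has_order_def)

lemma has_orderE:
  assumes "has_order B G n f"
  obtains g c where "(n, g) \<in> G" "c \<noteq> 0" "f - fun_scale c g \<in> order_less B G n"
  using assms by (auto simp: has_order_def)

lemma has_order_generator: "(n, f) \<in> G \<Longrightarrow> has_order B G n f"
  by (rule has_orderI[of n f G 1]) simp_all

lemma has_order_add_lower:
  assumes "has_order B G n f" "g \<in> order_less B G n"
  shows "has_order B G n (f + g)"
proof -
  obtain h c where leading: "(n, h) \<in> G" "c \<noteq> 0" "f - fun_scale c h \<in> order_less B G n"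
    using assms(1) by (rule has_orderE)
  have "f + g - fun_scale c h \<in> order_less B G n"
    using order_less_add[OF leading(3) assms(2)] by (simp add: algebra_simps)
  with leading(1,2) show ?thesis by (rule has_orderI)
qed

lemma has_order_cong:
  assumes "has_order B G n f" "\<And>b. b \<in> B \<Longrightarrow> g b = f b"
  shows "has_order B G n g"
proof -
  have "g - f \<in> vanishing_on B" using assms(2) by (simp add: vanishing_on_def)
  then have "g - f \<in> order_less B G n" using vanishing_on_subset_order_less by blast
  from has_order_add_lower[OF assms(1) this] show ?thesis by simp
qed

lemma has_order_imp_order_le:
  assumes "has_order B G n f"
  shows "f \<in> order_less B G (Suc n)"
proof -
  obtain g c where "(n, g) \<in> G" and lower: "f - fun_scale c g \<in> order_less B G n"
    using assms by (rule has_orderE)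
  then have "fun_scale c g \<in> order_less B G (Suc n)"
    by (intro order_less_scale order_lessI) auto
  moreover have "f - fun_scale c g \<in> order_less B G (Suc n)"
    using lower order_less_mono[of n "Suc n"] by auto
  ultimately show ?thesis using order_less_add by fastforce
qed

lemma order_less_Suc_cases [consumes 2, case_names lower exact]:
  assumes "single_valued G" "f \<in> order_less B G (Suc n)"
  obtains (lower) "f \<in> order_less B G n" | (exact) "has_order B G n f"
proof (cases "\<exists>g. (n, g) \<in> G")
  case True
  then obtain g where g_in: "(n, g) \<in> G" by blast
  have "(n, h) \<in> G \<longleftrightarrow> h = g" for h using single_valuedD[OF assms(1) g_in] g_in by blast
  then have "{f. \<exists>s<Suc n. (s, f) \<in> G} = insert g {f. \<exists>s<n. (s, f) \<in> G}"
    by (auto simp: less_Suc_eq)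
  then have "f \<in> fun_vs.span (insert g ({f. \<exists>s<n. (s, f) \<in> G} \<union> vanishing_on B))"
    using assms(2) by (simp add: order_less_def)
  then obtain c where remainder: "f - fun_scale c g \<in> order_less B G n"
    unfolding order_less_def fun_vs.span_breakdown_eq by blast
  show thesis
  proof (cases "c = 0")
    case True
    then show thesis using remainder lower by simp
  next
    case False
    then show thesis using exact has_orderI[OF g_in _ remainder] by blast
  qed
next
  case False
  then have "order_less B G (Suc n) = order_less B G n"
    unfolding order_less_def by (metis less_Suc_eq)
  then show thesis using assms(2) lower by simp
qed

locale order_basis =
  fixes B :: "'b set" and G :: "(nat \<times> ('b \<Rightarrow> 'a::field)) set"
  assumes single_valued: "single_valued G"
    and one: "(0, 1) \<in> G"
    and mult: "(m, f) \<in> G \<Longrightarrow> (n, g) \<in> G \<Longrightarrow> has_order B G (m + n) (f * g)"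
begin

lemma order_less_times:
  assumes "f \<in> order_less B G m" "g \<in> order_less B G (Suc n)"
  shows "f * g \<in> order_less B G (m + n)" (is "_ \<in> ?V")
proof -
  have vanish: "h * k \<in> ?V" "k * h \<in> ?V" if "h \<in> vanishing_on B" for h k
    using vanishing_on_times[OF that, of k] vanishing_on_subset_order_less
    by (auto simp: mult.commute)
  have "f * h \<in> ?V" if h_in: "(r, h) \<in> G" "r < Suc n" for r h
  proof -
    have "f \<in> {f. f * h \<in> ?V}"
    proof (rule order_less_induct[OF assms(1) subspace_times_preimage[OF subspace_order_less]])
      fix s k assume k_in: "(s, k) \<in> G" "s < m"
      have "order_less B G (Suc (s + r)) \<subseteq> ?V"
        using k_in(2) h_in(2) by (intro order_less_mono) simp
      then show "k \<in> {f. f * h \<in> ?V}"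
        using has_order_imp_order_le[OF mult[OF k_in(1) h_in(1)]] by blast
    qed (use vanish in auto)
    then show ?thesis by simp
  qed
  then have "g \<in> {g. g * f \<in> ?V}"
    by (intro order_less_induct[OF assms(2) subspace_times_preimage[OF subspace_order_less]])
      (use vanish in \<open>auto simp: mult.commute\<close>)
  then show ?thesis by (simp add: mult.commute)
qed

lemma has_order_times:
  assumes "has_order B G m f" "has_order B G n g"
  shows "has_order B G (m + n) (f * g)"
proof -
  obtain f' c where f_leading: "(m, f') \<in> G" "c \<noteq> 0" "f - fun_scale c f' \<in> order_less B G m"
    using assms(1) by (rule has_orderE)
  obtain g' d where g_leading: "(n, g') \<in> G" "d \<noteq> 0" "g - fun_scale d g' \<in> order_less B G n"
    using assms(2) by (rule has_orderE)
  obtain h b where product_leading: "(m + n, h) \<in> G" "b \<noteq> 0"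
      "f' * g' - fun_scale b h \<in> order_less B G (m + n)"
    using mult[OF f_leading(1) g_leading(1)] by (rule has_orderE)
  have "(f - fun_scale c f') * g \<in> order_less B G (m + n)"
    using f_leading(3) has_order_imp_order_le[OF assms(2)] by (rule order_less_times)
  moreover have "(g - fun_scale d g') * f' \<in> order_less B G (n + m)"
    using g_leading(3) order_lessI[OF f_leading(1)] by (intro order_less_times) auto
  ultimately have "(f - fun_scale c f') * g + fun_scale c ((g - fun_scale d g') * f')
      + fun_scale (c * d) (f' * g' - fun_scale b h) \<in> order_less B G (m + n)"
    using product_leading(3) by (intro order_less_add order_less_scale) (simp_all only: add.commute)
  also have "(f - fun_scale c f') * g + fun_scale c ((g - fun_scale d g') * f')
      + fun_scale (c * d) (f' * g' - fun_scale b h) = f * g - fun_scale (c * d * b) h"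
    by (simp add: fun_eq_iff fun_scale_def algebra_simps)
  finally show ?thesis by (rule has_orderI[OF product_leading(1), rotated])
      (simp add: product_leading(2) f_leading(2) g_leading(2))
qed

lemma order_le_times:
  assumes "f \<in> order_less B G (Suc m)" "g \<in> order_less B G (Suc n)"
  shows "f * g \<in> order_less B G (Suc (m + n))"
  using order_less_times[OF assms] by simp

lemma order_le_one: "1 \<in> order_less B G (Suc n)"
  using one by (rule order_lessI) simp

lemma order_le_power: "f \<in> order_less B G (Suc m) \<Longrightarrow> f ^ k \<in> order_less B G (Suc (k * m))"
proof (induction k)
  case 0
  show ?case by (simp only: power_0 order_le_one)
next
  case (Suc k)
  then show ?case using order_le_times[of f m "f ^ k" "k * m"] by (simp only: power_Suc mult_Suc)
qed

lemma order_le_prod: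
  assumes "\<And>i. i \<in> I \<Longrightarrow> f i \<in> order_less B G (Suc (m i))"
  shows "(\<Prod>i\<in>I. f i) \<in> order_less B G (Suc (\<Sum>i\<in>I. m i))"
  using assms
proof (induction I rule: infinite_finite_induct)
  case (insert i I)
  then have "f i * (\<Prod>i\<in>I. f i) \<in> order_less B G (Suc (m i + (\<Sum>i\<in>I. m i)))"
    by (intro order_le_times) auto
  then show ?case using insert.hyps by (simp only: prod.insert sum.insert not_False_eq_True)
qed (simp_all only: prod.infinite prod.empty order_le_one not_False_eq_True)

lemma interpolation_if_separates:
  assumes "finite Z"
    and separates: "\<And>P R. P \<in> Z \<Longrightarrow> R \<in> Z \<Longrightarrow> P \<noteq> R \<Longrightarrow>
      \<exists>n. \<exists>f \<in> order_less B G (Suc n). f P \<noteq> f R"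
  shows "\<exists>n. \<exists>f \<in> order_less B G n. \<forall>P\<in>Z. f P = g P"
proof -
  let ?A = "\<Union>n. order_less B G (Suc n)"
  have "fun_vs.subspace ?A"
  proof (rule fun_vs.subspaceI)
    show "0 \<in> ?A" by simp
    show "fun_scale c f \<in> ?A" if "f \<in> ?A" for c f using that order_less_scale by blast
    fix f g assume "f \<in> ?A" "g \<in> ?A"
    then obtain m n where "f \<in> order_less B G (Suc m)" "g \<in> order_less B G (Suc n)" by blast
    then have "f \<in> order_less B G (Suc (max m n))" "g \<in> order_less B G (Suc (max m n))"
      using order_less_mono[of "Suc m" "Suc (max m n)" B G]
        order_less_mono[of "Suc n" "Suc (max m n)" B G] by auto
    then show "f + g \<in> ?A" using order_less_add by blast
  qed
  then have "\<exists>f\<in>?A. \<forall>P\<in>Z. f P = g P"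
  proof (rule separating_subalgebra_interpolates[OF _ _ _ assms(1)])
    show "1 \<in> ?A" using order_le_one by blast
    show "f * g \<in> ?A" if "f \<in> ?A" "g \<in> ?A" for f g using that order_le_times by blast
    show "\<exists>f\<in>?A. f P \<noteq> f R" if "P \<in> Z" "R \<in> Z" "P \<noteq> R" for P R
      using separates[OF that] by blast
  qed
  then show ?thesis by blast
qed

end

text \<open>The elements of \<open>S - (w + S)\<close> are the least elements of \<open>S\<close> in their classes modulo \<open>w\<close>.\<close>

lemma card_Diff_translate_le:
  fixes S :: "nat set"
  assumes add: "\<And>s. s \<in> S \<Longrightarrow> w + s \<in> S"
  shows "finite (S - (+) w ` S)" "card (S - (+) w ` S) \<le> w"
proof -
  have inj: "inj_on (\<lambda>s. s mod w) (S - (+) w ` S)"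
  proof (rule linorder_inj_onI)
    fix r s assume "r < s" and r_in: "r \<in> S - (+) w ` S" and s_in: "s \<in> S - (+) w ` S"
    show "r mod w \<noteq> s mod w"
    proof
      assume "r mod w = s mod w"
      then have "w dvd s - r" using \<open>r < s\<close> mod_eq_dvd_iff_nat[of r s w] by simp
      then obtain k where s_eq: "s = r + w * k"
        using \<open>r < s\<close> by (metis dvdE le_add_diff_inverse less_imp_le)
      then obtain k' where "k = Suc k'" using \<open>r < s\<close> by (cases k) auto
      moreover have "r + w * k' \<in> S"
      proof (induction k')
        case (Suc k')
        then show ?case using add[of "r + w * k'"] by (simp add: add.left_commute)
      qed (use r_in in simp)
      ultimately have "s \<in> (+) w ` S" using s_eq by (intro image_eqI[of _ _ "r + w * k'"]) auto
      then show False using s_in by blast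
    qed
  qed auto
  have residues: "(\<lambda>s. s mod w) ` (S - (+) w ` S) \<subseteq> {..<w}" by (cases "w = 0") auto
  show "finite (S - (+) w ` S)" using inj_on_finite[OF inj residues] by simp
  show "card (S - (+) w ` S) \<le> w" using card_inj_on_le[OF inj residues] by simp
qed

context order_basis
begin

lemma generator_in_span_modulo_multiples:
  assumes "has_order B G w F" "Z \<subseteq> B" "F \<in> vanishing_on Z"
  shows "(n, g) \<in> G \<Longrightarrow>
    g \<in> fun_vs.span (snd ` {u \<in> G. fst u \<notin> (+) w ` fst ` G} \<union> vanishing_on Z)"
    (is "_ \<Longrightarrow> _ \<in> fun_vs.span ?T")
proof (induction n arbitrary: g rule: less_induct)
  case (less n)
  show ?case
  proof (cases "n \<in> (+) w ` fst ` G")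
    case False
    then have "g \<in> ?T" using less.prems by force
    then show ?thesis by (rule fun_vs.span_base)
  next
    case True
    then obtain v h where n_eq: "n = w + v" and h_in: "(v, h) \<in> G" by auto
    have "has_order B G n (F * h)"
      unfolding n_eq using assms(1) has_order_generator[OF h_in] by (rule has_order_times)
    then obtain c where "c \<noteq> 0" and lower: "F * h - fun_scale c g \<in> order_less B G n"
      using single_valuedD[OF single_valued less.prems] by (metis has_orderE)
    have "F * h \<in> fun_vs.span ?T"
      using vanishing_on_times[OF assms(3)] by (blast intro: fun_vs.span_base)
    moreover have "F * h - fun_scale c g \<in> fun_vs.span ?T"
      using lower fun_vs.subspace_span
    proof (rule order_less_induct)
      show "vanishing_on B \<subseteq> fun_vs.span ?T"
        using vanishing_on_antimono[OF assms(2)] by (blast intro: fun_vs.span_base)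
    qed (rule less.IH)
    ultimately have "F * h - (F * h - fun_scale c g) \<in> fun_vs.span ?T" by (rule fun_vs.span_diff)
    then have "fun_scale c g \<in> fun_vs.span ?T" by simp
    then have "fun_scale (inverse c) (fun_scale c g) \<in> fun_vs.span ?T" by (rule fun_vs.span_scale)
    then show ?thesis using \<open>c \<noteq> 0\<close> by simp
  qed
qed

lemma order_less_subset_span_modulo_multiples:
  assumes "has_order B G w F" "Z \<subseteq> B" "F \<in> vanishing_on Z"
  shows "order_less B G n \<subseteq>
    fun_vs.span (snd ` {u \<in> G. fst u \<notin> (+) w ` fst ` G} \<union> vanishing_on Z)"
    (is "_ \<subseteq> fun_vs.span ?T")
proof
  fix g assume "g \<in> order_less B G n"
  then show "g \<in> fun_vs.span ?T"
  proof (rule order_less_induct[OF _ fun_vs.subspace_span])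
    show "vanishing_on B \<subseteq> fun_vs.span ?T"
      using vanishing_on_antimono[OF assms(2)] by (blast intro: fun_vs.span_base)
  qed (rule generator_in_span_modulo_multiples[OF assms])
qed

theorem card_zeros_le_order:
  assumes F_order: "F \<in> order_less B G (Suc N)" and F_nonzero: "F \<notin> vanishing_on B"
    and Z: "Z \<subseteq> B" "finite Z" and F_zero: "F \<in> vanishing_on Z"
    and interpolation: "\<And>g. \<exists>n. \<exists>f \<in> order_less B G n. \<forall>P\<in>Z. f P = g P"
  shows "card Z \<le> N"
proof -
  have "F \<notin> order_less B G 0" using F_nonzero by (simp add: order_less_0)
  with F_order obtain w where least: "w \<le> N" "F \<in> order_less B G (Suc w)" "F \<notin> order_less B G w"
    using ex_least_nat_less[of "\<lambda>n. F \<in> order_less B G n" "Suc N"] by (auto simp: less_Suc_eq_le)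
  from single_valued least(2) have order: "has_order B G w F"
    by (cases rule: order_less_Suc_cases) (use least(3) in auto)
  define S where "S = fst ` G"
  define U where "U = {u \<in> G. fst u \<notin> (+) w ` S}"
  obtain f where "(w, f) \<in> G" using order by (rule has_orderE)
  then have "w + s \<in> S" if "s \<in> S" for s
    using that mult by (force simp: S_def elim: has_orderE)
  then have complement: "finite (S - (+) w ` S)" "card (S - (+) w ` S) \<le> w"
    using card_Diff_translate_le[of S w] by blast+
  have inj: "inj_on fst U"
    using single_valuedD[OF single_valued] by (auto simp: U_def inj_on_def)
  have orders: "fst ` U \<subseteq> S - (+) w ` S" by (auto simp: U_def S_def)
  have "finite U" using inj orders complement(1) by (rule inj_on_finite)
  have "card Z \<le> card (snd ` U)"
  proof (rule card_le_if_spans_functions[OF Z(2)])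
    show "finite (snd ` U)" using \<open>finite U\<close> by simp
    show "\<exists>f \<in> fun_vs.span (snd ` U \<union> vanishing_on Z). \<forall>P\<in>Z. f P = g P" for g
      using interpolation[of g] order_less_subset_span_modulo_multiples[OF order Z(1) F_zero]
      unfolding U_def S_def by blast
  qed
  also have "\<dots> \<le> card U" using \<open>finite U\<close> by (rule card_image_le)
  also have "\<dots> \<le> card (S - (+) w ` S)" using inj orders complement(1) by (rule card_inj_on_le)
  finally show ?thesis using complement(2) least(1) by linarith
qed

end

lemma order_basis_powers: "order_basis B (range (\<lambda>n. (n, f ^ n)))"
proof
  show "single_valued (range (\<lambda>n. (n, f ^ n)))" by (auto simp: single_valued_def)
  show "(0, 1) \<in> range (\<lambda>n. (n, f ^ n))" by (rule range_eqI[of _ _ 0]) simp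
next
  fix m g n h assume "(m, g) \<in> range (\<lambda>n. (n, f ^ n))" "(n, h) \<in> range (\<lambda>n. (n, f ^ n))"
  then have "(m + n, g * h) \<in> range (\<lambda>n. (n, f ^ n))" by (auto simp: power_add)
  then show "has_order B (range (\<lambda>n. (n, f ^ n))) (m + n) (g * h)" by (rule has_order_generator)
qed

section \<open>Adjoining roots of Artin--Schreier equations\<close>

lemma prime_mult_add_cancel:
  fixes p m :: nat
  assumes "prime p" "\<not> p dvd m" "d < p" "e < p" "p * a + m * d = p * b + m * e"
  shows "a = b \<and> d = e"
  using assms(3-5)
proof (induction d e arbitrary: a b rule: linorder_wlog)
  case (le d e)
  then have "p * a = p * b + m * (e - d)" by (simp add: diff_mult_distrib2)
  then have "p dvd m * (e - d)" by (metis dvd_add_right_iff dvd_triv_left)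
  then have "p dvd e - d" using assms(1,2) by (simp add: prime_dvd_mult_iff)
  then have "d = e" using le by (auto dest: dvd_imp_le)
  then show ?case using le assms(1) by simp
qed metis

definition adjoin_root ::
    "nat \<Rightarrow> nat \<Rightarrow> ('b \<Rightarrow> 'a::field) \<Rightarrow> (nat \<times> ('b \<Rightarrow> 'a)) set \<Rightarrow> (nat \<times> ('b \<Rightarrow> 'a)) set" where
  "adjoin_root p m z G = {(p * s + m * e, f * z ^ e) | s f e. (s, f) \<in> G \<and> e < p}"

lemma adjoin_rootI: "(s, f) \<in> G \<Longrightarrow> e < p \<Longrightarrow> (p * s + m * e, f * z ^ e) \<in> adjoin_root p m z G"
  by (auto simp: adjoin_root_def)

lemma adjoin_rootE:
  assumes "(n, f) \<in> adjoin_root p m z G"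
  obtains s g e where "n = p * s + m * e" "f = g * z ^ e" "(s, g) \<in> G" "e < p"
  using assms by (auto simp: adjoin_root_def)

lemma times_power_in_order_less_adjoin_root:
  assumes "h \<in> order_less B G n" "e < p" "\<And>s. s < n \<Longrightarrow> p * s + m * e < k"
  shows "h * z ^ e \<in> order_less B (adjoin_root p m z G) k"
proof -
  let ?S = "{f. f * z ^ e \<in> order_less B (adjoin_root p m z G) k}"
  have "h \<in> ?S"
  proof (rule order_less_induct[OF assms(1) subspace_times_preimage[OF subspace_order_less]])
    show "vanishing_on B \<subseteq> ?S"
      using vanishing_on_times vanishing_on_subset_order_less by blast
    show "g \<in> ?S" if "(s, g) \<in> G" "s < n" for s g
      using adjoin_rootI[OF that(1) assms(2)] assms(3)[OF that(2)] by (auto intro: order_lessI)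
  qed
  then show ?thesis by simp
qed

lemma order_le_adjoin_root:
  assumes "h \<in> order_less B G (Suc n)" "0 < p"
  shows "h \<in> order_less B (adjoin_root p m z G) (Suc (p * n))"
  using times_power_in_order_less_adjoin_root[OF assms, where m = m and z = z and k = "Suc (p * n)"]
  by (simp add: less_Suc_eq_le)

lemma has_order_adjoin_root:
  assumes "has_order B G n f" "e < p"
  shows "has_order B (adjoin_root p m z G) (p * n + m * e) (f * z ^ e)"
proof -
  obtain g c where leading: "(n, g) \<in> G" "c \<noteq> 0" "f - fun_scale c g \<in> order_less B G n"
    using assms(1) by (rule has_orderE)
  have "(f - fun_scale c g) * z ^ e \<in> order_less B (adjoin_root p m z G) (p * n + m * e)"
    using leading(3) assms(2) by (rule times_power_in_order_less_adjoin_root) (use assms(2) in simp)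
  also have "(f - fun_scale c g) * z ^ e = f * z ^ e - fun_scale c (g * z ^ e)"
    by (simp add: fun_eq_iff fun_scale_def algebra_simps)
  finally show ?thesis by (rule has_orderI[OF adjoin_rootI[OF leading(1) assms(2)] leading(2)])
qed

lemma single_valued_adjoin_root:
  assumes "single_valued G" "prime p" "\<not> p dvd m"
  shows "single_valued (adjoin_root p m z G)"
proof (rule single_valuedI)
  fix n f g assume "(n, f) \<in> adjoin_root p m z G" and "(n, g) \<in> adjoin_root p m z G"
  obtain r f' d where f_decomp: "n = p * r + m * d" "f = f' * z ^ d" "(r, f') \<in> G" "d < p"
    using \<open>(n, f) \<in> adjoin_root p m z G\<close> by (rule adjoin_rootE)
  obtain s g' e where g_decomp: "n = p * s + m * e" "g = g' * z ^ e" "(s, g') \<in> G" "e < p"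
    using \<open>(n, g) \<in> adjoin_root p m z G\<close> by (rule adjoin_rootE)
  have "r = s \<and> d = e" using f_decomp g_decomp by (intro prime_mult_add_cancel[OF assms(2,3)]) auto
  then show "f = g" using f_decomp g_decomp single_valuedD[OF assms(1)] by blast
qed

lemma (in order_basis) has_order_adjoin_root_power:
  assumes "(m, X) \<in> G" "p > 1" "m > 0" "Suc e < p"
    and root: "\<And>b. b \<in> B \<Longrightarrow> z b ^ p = X b + \<gamma> * z b"
    and order: "has_order B G n f"
  shows "has_order B (adjoin_root p m z G) (p * n + m * (p + e)) (f * z ^ (p + e))"
proof -
  let ?G = "adjoin_root p m z G" and ?k = "p * n + m * (p + e)"
  have "has_order B ?G (p * (n + m) + m * e) (f * X * z ^ e)"
    using assms(1,4) by (intro has_order_adjoin_root has_order_times order has_order_generator) auto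
  then have "has_order B ?G ?k (f * X * z ^ e)" by (simp add: algebra_simps)
  moreover have "f * z ^ Suc e \<in> order_less B ?G ?k"
    using has_order_imp_order_le[OF order] assms(4)
  proof (rule times_power_in_order_less_adjoin_root)
    fix i assume "i < Suc n"
    then have "p * i \<le> p * n" by simp
    moreover have "m < p * m" using assms(2,3) by simp
    ultimately have "p * i + m < p * n + p * m" by (rule add_le_less_mono)
    then show "p * i + m * Suc e < ?k" by (simp add: distrib_left mult.commute[of m p])
  qed
  ultimately have "has_order B ?G ?k (f * X * z ^ e + fun_scale \<gamma> (f * z ^ Suc e))"
    by (intro has_order_add_lower order_less_scale)
  then show ?thesis
    by (rule has_order_cong)
      (simp add: root fun_scale_def power_fun_apply power_add algebra_simps)
qed

theorem order_basis_adjoin_root: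
  assumes "order_basis B G" "(m, X) \<in> G" "prime p" "\<not> p dvd m"
    and root: "\<And>b. b \<in> B \<Longrightarrow> z b ^ p = X b + \<gamma> * z b"
  shows "order_basis B (adjoin_root p m z G)"
proof -
  interpret order_basis B G by fact
  let ?G = "adjoin_root p m z G"
  have "p > 1" using assms(3) by (rule prime_gt_1_nat)
  have "m > 0" using assms(4) by (cases m) auto
  show ?thesis
  proof
    show "single_valued ?G" using single_valued assms(3,4) by (rule single_valued_adjoin_root)
    show "(0, 1) \<in> ?G" using adjoin_rootI[OF one, of 0 p m z] \<open>p > 1\<close> by simp
  next
    fix k f n g assume "(k, f) \<in> ?G" and "(n, g) \<in> ?G"
    obtain r f' d where f_decomp: "k = p * r + m * d" "f = f' * z ^ d" "(r, f') \<in> G" "d < p"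
      using \<open>(k, f) \<in> ?G\<close> by (rule adjoin_rootE)
    obtain s g' e where g_decomp: "n = p * s + m * e" "g = g' * z ^ e" "(s, g') \<in> G" "e < p"
      using \<open>(n, g) \<in> ?G\<close> by (rule adjoin_rootE)
    have order: "has_order B G (r + s) (f' * g')" using f_decomp(3) g_decomp(3) by (rule mult)
    have "has_order B ?G (p * (r + s) + m * (d + e)) (f' * g' * z ^ (d + e))"
    proof (cases "d + e < p")
      case True
      with order show ?thesis by (rule has_order_adjoin_root)
    next
      case False
      then obtain E where carry: "d + e = p + E" "Suc E < p"
        using f_decomp(4) g_decomp(4) by (auto simp: not_less le_iff_add)
      show ?thesis
        unfolding carry(1) using assms(2) \<open>p > 1\<close> \<open>m > 0\<close> carry(2) root order
        by (rule has_order_adjoin_root_power)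
    qed
    then show "has_order B ?G (k + n) (f * g)"
      by (simp add: f_decomp(1,2) g_decomp(1,2) power_add algebra_simps)
  qed
qed

lemma artin_schreier_scale:
  fixes x y c :: "'a::field"
  assumes "c \<noteq> 0" "y ^ p - y = c ^ p * x"
  shows "(inverse c * y) ^ p = x + c / c ^ p * (inverse c * y)"
proof -
  have "y ^ p = y + c ^ p * x" using assms(2) by (simp add: algebra_simps)
  then show ?thesis using assms(1) by (simp add: power_mult_distrib power_inverse field_simps)
qed

lemma artin_schreier_reduce:
  fixes x y z b \<gamma> :: "'a::field"
  assumes "prime p" "CHAR('a) = p" "z ^ p = x + \<gamma> * z" "y ^ p - y = b ^ p * x"
  shows "(y - b * z) ^ p - (y - b * z) = (b - \<gamma> * b ^ p) * z"
proof -
  have "y ^ p = y + b ^ p * x" using assms(4) by (simp add: algebra_simps)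
  then show ?thesis
    using frobenius_diff[OF assms(1,2), of y "b * z" 1] assms(3)
    by (simp add: power_mult_distrib algebra_simps)
qed

lemma artin_schreier_system_reduce:
  fixes y :: "'i \<Rightarrow> 'b \<Rightarrow> 'a::field"
  assumes "prime p" "CHAR('a) = p" "surj (\<lambda>z::'a. z ^ p)" "finite I" "k \<notin> I"
    and "lin_indep_over prime_subfield (insert k I) a"
    and system: "\<And>i P. i \<in> insert k I \<Longrightarrow> P \<in> B \<Longrightarrow> y i P ^ p - y i P = a i * X P"
  obtains z \<gamma> b a' where "\<forall>P\<in>B. z P ^ p = X P + \<gamma> * z P"
    and "y k = fun_scale (b k) z" "lin_indep_over prime_subfield I a'"
    and "\<forall>i\<in>I. \<forall>P\<in>B.
      (y i - fun_scale (b i) z) P ^ p - (y i - fun_scale (b i) z) P = a' i * z P"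
proof -
  define b where "b i = inv (\<lambda>z. z ^ p) (a i)" for i
  have a_eq: "a i = b i ^ p" for i using surj_f_inv_f[OF assms(3), of "a i"] by (simp add: b_def)
  then have indep: "lin_indep_over prime_subfield (insert k I) (\<lambda>i. b i ^ p)"
    using assms(6) by (simp add: lin_indep_over_def)
  have "b k \<noteq> 0"
    using lin_indep_over_nonzero[OF indep, of k] assms(1,4) by (auto simp: prime_gt_0_nat)
  define z where "z = fun_scale (inverse (b k)) (y k)"
  have system': "y i P ^ p - y i P = b i ^ p * X P" if "i \<in> insert k I" "P \<in> B" for i P
    using system[OF that] by (simp add: a_eq)
  have root: "z P ^ p = X P + b k / b k ^ p * z P" if "P \<in> B" for P
    using artin_schreier_scale[OF \<open>b k \<noteq> 0\<close> system'[OF _ that, of k]]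
    by (simp add: z_def fun_scale_def)
  show thesis
  proof (rule that)
    show "\<forall>P\<in>B. z P ^ p = X P + b k / b k ^ p * z P" using root by blast
    show "y k = fun_scale (b k) z" using \<open>b k \<noteq> 0\<close> by (simp add: z_def)
    show "lin_indep_over prime_subfield I (\<lambda>i. b i - b k / b k ^ p * b i ^ p)"
      using assms(1,2,4,5) indep by (rule lin_indep_over_frobenius_twist)
    show "\<forall>i\<in>I. \<forall>P\<in>B. (y i - fun_scale (b i) z) P ^ p - (y i - fun_scale (b i) z) P
        = (b i - b k / b k ^ p * b i ^ p) * z P"
      using artin_schreier_reduce[OF assms(1,2) root system'] by (simp add: fun_scale_def)
  qed
qed

theorem order_basis_artin_schreier:
  fixes y :: "'i \<Rightarrow> 'b \<Rightarrow> 'a::field"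
  assumes "prime p" "CHAR('a) = p" "surj (\<lambda>z::'a. z ^ p)" "\<not> p dvd m"
    and "finite I" "order_basis B G" "(m, X) \<in> G" "lin_indep_over prime_subfield I a"
    and "\<And>i P. i \<in> I \<Longrightarrow> P \<in> B \<Longrightarrow> y i P ^ p - y i P = a i * X P"
  obtains G' where "order_basis B G'"
    and "\<And>n. order_less B G (Suc n) \<subseteq> order_less B G' (Suc (p ^ card I * n))"
    and "\<And>i. i \<in> I \<Longrightarrow> y i \<in> order_less B G' (Suc (p ^ (card I - 1) * m))"
  using assms(5-)
proof (induction I arbitrary: G X a y thesis rule: finite_induct)
  case empty
  then show ?case by simp
next
  case (insert k I)
  have "p > 1" using assms(1) by (rule prime_gt_1_nat)
  obtain z \<gamma> b a' where root: "\<forall>P\<in>B. z P ^ p = X P + \<gamma> * z P"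
    and y_k: "y k = fun_scale (b k) z" and indep: "lin_indep_over prime_subfield I a'"
    and system: "\<forall>i\<in>I. \<forall>P\<in>B.
      (y i - fun_scale (b i) z) P ^ p - (y i - fun_scale (b i) z) P = a' i * z P"
    by (rule artin_schreier_system_reduce[OF assms(1-3) insert.hyps insert.prems(4,5)])
  define y' where "y' i = y i - fun_scale (b i) z" for i
  let ?G = "adjoin_root p m z G"
  have "order_basis B ?G"
    using insert.prems(2,3) assms(1,4) bspec[OF root] by (rule order_basis_adjoin_root)
  moreover have z_in: "(m, z) \<in> ?G"
    using adjoin_rootI[OF order_basis.one[OF insert.prems(2)] \<open>p > 1\<close>, of m z] by simp
  moreover have "y' i P ^ p - y' i P = a' i * z P" if "i \<in> I" "P \<in> B" for i P
    using system that by (simp add: y'_def)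
  ultimately obtain G' where "order_basis B G'"
    and up: "\<And>n. order_less B ?G (Suc n) \<subseteq> order_less B G' (Suc (p ^ card I * n))"
    and y'_order: "\<And>i. i \<in> I \<Longrightarrow> y' i \<in> order_less B G' (Suc (p ^ (card I - 1) * m))"
    using insert.IH indep by blast
  have card: "card (insert k I) = Suc (card I)" using insert.hyps by simp
  show ?case
  proof (rule insert.prems(1)[OF \<open>order_basis B G'\<close>])
    show "order_less B G (Suc n) \<subseteq> order_less B G' (Suc (p ^ card (insert k I) * n))" for n
      using order_le_adjoin_root[of _ B G n p m z] up[of "p * n"] \<open>p > 1\<close>
      by (auto simp: card mult_ac)
    fix i assume "i \<in> insert k I"
    then have "y' i \<in> order_less B G' (Suc (p ^ (card I - 1) * m))"
      using y'_order y_k by (auto simp: y'_def)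
    moreover have "z \<in> order_less B G' (Suc (p ^ card I * m))"
      using up order_lessI[OF z_in] by blast
    moreover have "Suc (p ^ (card I - 1) * m) \<le> Suc (p ^ card I * m)"
      using \<open>p > 1\<close> by (simp add: power_increasing)
    ultimately have "y' i + fun_scale (b i) z \<in> order_less B G' (Suc (p ^ card I * m))"
      by (rule order_less_add_scale)
    then show "y i \<in> order_less B G' (Suc (p ^ (card (insert k I) - 1) * m))"
      by (simp add: card y'_def)
  qed
qed

section \<open>Zeros of functions on the curve\<close>

lemma monomial_eq_prod: "monomial t j e = fst ^ j * (\<Prod>i=1..t. (\<lambda>P. snd P i) ^ e i)"
  by (simp add: monomial_def fun_eq_iff power_fun_apply prod_fun_apply)

lemma order_basis_of_artin_schreier_curve:
  fixes a :: "nat \<Rightarrow> 'a::{field,finite}"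
  assumes "prime p" "CARD('a) = p ^ r" "\<not> p dvd m" "lin_indep_over prime_subfield {1..t} a"
    and curve: "\<And>P i. P \<in> B \<Longrightarrow> i \<in> {1..t} \<Longrightarrow> snd P i ^ p - snd P i = a i * fst P ^ m"
  obtains G where "order_basis B G" "fst \<in> order_less B G (Suc (p ^ t))"
    and "\<And>i. i \<in> {1..t} \<Longrightarrow> (\<lambda>P. snd P i) \<in> order_less B G (Suc (p ^ (t - 1) * m))"
proof -
  let ?X = "range (\<lambda>n. (n, fst ^ n :: 'a point \<Rightarrow> 'a))"
  have power_in: "(m, fst ^ m) \<in> ?X" by blast
  have "snd P i ^ p - snd P i = a i * (fst ^ m) P" if "i \<in> {1..t}" "P \<in> B" for i P
    using curve[OF that(2,1)] by (simp add: power_fun_apply)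
  from order_basis_artin_schreier[OF assms(1) CHAR_eq_of_card_eq_prime_power[OF assms(1,2)]
      surj_frobenius[OF assms(1,2)] assms(3) finite_atLeastAtMost order_basis_powers power_in
      assms(4) this]
  obtain G where "order_basis B G"
    and up: "\<And>n. order_less B ?X (Suc n) \<subseteq> order_less B G (Suc (p ^ t * n))"
    and y_order: "\<And>i. i \<in> {1..t} \<Longrightarrow> (\<lambda>P. snd P i) \<in> order_less B G (Suc (p ^ (t - 1) * m))"
    by auto
  have "(1, fst) \<in> ?X" by (rule range_eqI[of _ _ 1]) simp
  then have "fst \<in> order_less B ?X (Suc 1)" by (rule order_lessI) simp
  then have "fst \<in> order_less B G (Suc (p ^ t))" using up[of 1] by auto
  with \<open>order_basis B G\<close> show thesis using y_order by (rule that)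
qed

theorem card_zeros_le_weight:
  fixes a :: "nat \<Rightarrow> 'a::{field,finite}"
  assumes "prime p" "CARD('a) = p ^ r" "\<not> p dvd m" "lin_indep_over prime_subfield {1..t} a"
    and ext: "\<And>P. P \<in> B \<Longrightarrow> snd P \<in> extensional {1..t}"
    and curve: "\<And>P i. P \<in> B \<Longrightarrow> i \<in> {1..t} \<Longrightarrow> snd P i ^ p - snd P i = a i * fst P ^ m"
    and F_weight: "F \<in> fun_vs.span {monomial t j e | j e.
      p ^ t * j + p ^ (t - 1) * m * (\<Sum>i=1..t. e i) \<le> N}"
    and F_nonzero: "F \<notin> vanishing_on B"
    and Z: "Z \<subseteq> B" "finite Z" and F_zero: "F \<in> vanishing_on Z"
  shows "card Z \<le> N"
proof -
  obtain G where "order_basis B G" and x_order: "fst \<in> order_less B G (Suc (p ^ t))"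
    and y_order: "\<And>i. i \<in> {1..t} \<Longrightarrow> (\<lambda>P. snd P i) \<in> order_less B G (Suc (p ^ (t - 1) * m))"
    using order_basis_of_artin_schreier_curve[OF assms(1-4) curve] by blast
  interpret order_basis B G by fact
  show ?thesis
  proof (rule card_zeros_le_order[OF _ F_nonzero Z F_zero])
    have "monomial t j e \<in> order_less B G (Suc N)"
      if weight: "p ^ t * j + p ^ (t - 1) * m * (\<Sum>i=1..t. e i) \<le> N" for j e
    proof -
      let ?n = "j * p ^ t + (\<Sum>i=1..t. e i * (p ^ (t - 1) * m))"
      have "monomial t j e \<in> order_less B G (Suc ?n)"
        unfolding monomial_eq_prod
        by (intro order_le_times order_le_power order_le_prod x_order y_order)
      moreover have "?n \<le> N" using weight by (simp add: mult.commute flip: sum_distrib_right)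
      then have "order_less B G (Suc ?n) \<subseteq> order_less B G (Suc N)" by (intro order_less_mono) simp
      ultimately show ?thesis by blast
    qed
    then have "{monomial t j e | j e. p ^ t * j + p ^ (t - 1) * m * (\<Sum>i=1..t. e i) \<le> N}
        \<subseteq> order_less B G (Suc N)" by blast
    from fun_vs.span_minimal[OF this subspace_order_less] F_weight
    show "F \<in> order_less B G (Suc N)" by (rule subsetD)
    show "\<exists>n. \<exists>f \<in> order_less B G n. \<forall>P\<in>Z. f P = g P" for g
    proof (rule interpolation_if_separates[OF Z(2)])
      fix P R assume "P \<in> Z" "R \<in> Z" "P \<noteq> R"
      then have "snd P \<in> extensional {1..t}" "snd R \<in> extensional {1..t}" using Z(1) ext by blast+
      then have "fst P \<noteq> fst R \<or> (\<exists>i\<in>{1..t}. snd P i \<noteq> snd R i)"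
        using \<open>P \<noteq> R\<close> by (metis extensionalityI prod_eqI)
      then show "\<exists>n. \<exists>f \<in> order_less B G (Suc n). f P \<noteq> f R"
      proof
        assume "\<exists>i\<in>{1..t}. snd P i \<noteq> snd R i"
        then obtain i where "i \<in> {1..t}" "snd P i \<noteq> snd R i" by blast
        with y_order show ?thesis by (intro exI bexI[of _ "\<lambda>P. snd P i"]) auto
      qed (use x_order in blast)
    qed
  qed
qed

section \<open>Polynomial functions on grids\<close>

lemma poly_function_eq_0_imp_coeffs_eq_0:
  fixes b :: "nat \<Rightarrow> 'a::idom"
  assumes "card S > d" "\<And>x. x \<in> S \<Longrightarrow> (\<Sum>r\<le>d. b r * x ^ r) = 0" "r \<le> d"
  shows "b r = 0"
proof -
  define P where "P = (\<Sum>r\<le>d. monom (b r) r)"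
  have "degree P \<le> d"
    unfolding P_def by (rule degree_sum_le) (auto intro: order_trans[OF degree_monom_le])
  then have "P = 0"
    using assms(1,2) by (intro poly_eqI_degree[of S]) (auto simp: P_def poly_sum poly_monom)
  moreover have "coeff P r = b r"
    unfolding P_def coeff_sum using assms(3) by simp
  ultimately show ?thesis by simp
qed

lemma sum_PiE_insert:
  assumes "k \<notin> I"
  shows "(\<Sum>e \<in> PiE (insert k I) S. f e) = (\<Sum>r\<in>S k. \<Sum>e \<in> PiE I S. f (e(k := r)))"
  unfolding PiE_insert_eq sum.cartesian_product
  by (subst sum.reindex[OF inj_combinator[OF assms]]) (simp add: case_prod_unfold comp_def)

lemma polynomial_zero_on_grid_imp_coeffs_eq_0:
  fixes c :: "('i \<Rightarrow> nat) \<Rightarrow> 'a::idom"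
  assumes "finite I" "\<And>i. i \<in> I \<Longrightarrow> card (S i) > d"
    and "\<And>y. y \<in> PiE I S \<Longrightarrow> (\<Sum>e \<in> I \<rightarrow>\<^sub>E {..d}. c e * (\<Prod>i\<in>I. y i ^ e i)) = 0"
    and "e \<in> I \<rightarrow>\<^sub>E {..d}"
  shows "c e = 0"
  using assms
proof (induction I arbitrary: c e rule: finite_induct)
  case empty
  then show ?case by simp
next
  case (insert k I)
  have slice_zero: "(\<Sum>e \<in> I \<rightarrow>\<^sub>E {..d}. c (e(k := r)) * (\<Prod>i\<in>I. y i ^ e i)) = 0"
    if y_grid: "y \<in> PiE I S" and "r \<le> d" for y r
  proof (rule poly_function_eq_0_imp_coeffs_eq_0[OF _ _ \<open>r \<le> d\<close>, of "S k"])
    show "card (S k) > d" using insert.prems(1) by simp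
    fix x assume "x \<in> S k"
    have prod_upd: "(\<Prod>i\<in>insert k I. (y(k := x)) i ^ (e(k := r)) i) = x ^ r * (\<Prod>i\<in>I. y i ^ e i)"
      for r e
    proof -
      have "(\<Prod>i\<in>I. (y(k := x)) i ^ (e(k := r)) i) = (\<Prod>i\<in>I. y i ^ e i)"
        using insert.hyps(2) by (intro prod.cong) auto
      then show ?thesis using insert.hyps by simp
    qed
    have "0 = (\<Sum>e \<in> insert k I \<rightarrow>\<^sub>E {..d}. c e * (\<Prod>i\<in>insert k I. (y(k := x)) i ^ e i))"
      using insert.prems(2)[OF PiE_fun_upd[where T = S, OF \<open>x \<in> S k\<close> y_grid]] by simp
    also have "\<dots> = (\<Sum>r\<le>d. \<Sum>e \<in> I \<rightarrow>\<^sub>E {..d}. c (e(k := r)) * (x ^ r * (\<Prod>i\<in>I. y i ^ e i)))"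
      unfolding sum_PiE_insert[OF insert.hyps(2)] prod_upd ..
    also have "\<dots> = (\<Sum>r\<le>d. (\<Sum>e \<in> I \<rightarrow>\<^sub>E {..d}. c (e(k := r)) * (\<Prod>i\<in>I. y i ^ e i)) * x ^ r)"
      by (simp add: sum_distrib_left mult_ac)
    finally show "(\<Sum>r\<le>d. (\<Sum>e \<in> I \<rightarrow>\<^sub>E {..d}. c (e(k := r)) * (\<Prod>i\<in>I. y i ^ e i)) * x ^ r) = 0" ..
  qed
  obtain r f where e_eq: "e = f(k := r)" and "r \<le> d" "f \<in> I \<rightarrow>\<^sub>E {..d}"
    using insert.prems(3) unfolding PiE_insert_eq by auto
  show ?case
    unfolding e_eq
    by (rule insert.IH[of "\<lambda>f. c (f(k := r))", OF insert.prems(1) slice_zero[OF _ \<open>r \<le> d\<close>]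
          \<open>f \<in> I \<rightarrow>\<^sub>E {..d}\<close>]) auto
qed

section \<open>Codes of evaluations\<close>

lemma linear_evaluation: "Vector_Spaces.linear fun_scale fun_scale (evaluation n Q)"
  by unfold_locales (simp_all add: evaluation_def fun_scale_def fun_eq_iff algebra_simps)

lemma linear_code_evaluation_image:
  assumes "fun_vs.subspace V"
  shows "linear_code n (evaluation n Q ` V)"
proof -
  interpret evaluation: Vector_Spaces.linear fun_scale fun_scale "evaluation n Q"
    by (rule linear_evaluation)
  show ?thesis
    using evaluation.subspace_image[OF assms]
    by (auto simp: linear_code_def words_def evaluation_def)
qed

lemma min_distance_ge:
  assumes "linear_code n C" "w\<^sub>0 \<in> C" "w\<^sub>0 \<noteq> 0"
    and weight: "\<And>w. w \<in> C \<Longrightarrow> w \<noteq> 0 \<Longrightarrow> d \<le> card {i \<in> {1..n}. w i \<noteq> 0}"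
  shows "d \<le> min_distance n C"
  unfolding min_distance_def
proof (rule cInf_greatest)
  have "0 \<in> C" using assms(1) by (simp add: linear_code_def fun_vs.subspace_0)
  then show "{hamming_dist n u v | u v. u \<in> C \<and> v \<in> C \<and> u \<noteq> v} \<noteq> {}" using assms(2,3) by blast
next
  fix k assume "k \<in> {hamming_dist n u v | u v. u \<in> C \<and> v \<in> C \<and> u \<noteq> v}"
  then obtain u v where k_eq: "k = hamming_dist n u v" and "u \<in> C" "v \<in> C" "u \<noteq> v" by blast
  then have "u - v \<in> C" using assms(1) by (simp add: linear_code_def fun_vs.subspace_diff)
  moreover have "u - v \<noteq> 0" using \<open>u \<noteq> v\<close> by simp
  ultimately have "d \<le> card {i \<in> {1..n}. (u - v) i \<noteq> 0}" by (rule weight)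
  then show "d \<le> k" by (simp add: k_eq hamming_dist_def)
qed

lemma evaluation_eq_0_iff:
  assumes "bij_betw Q {1..n} B"
  shows "evaluation n Q F = 0 \<longleftrightarrow> F \<in> vanishing_on B"
  unfolding evaluation_def vanishing_on_def bij_betw_imp_surj_on[OF assms, symmetric]
  by (auto simp: fun_eq_iff)

lemma weight_evaluation:
  assumes "bij_betw Q {1..n} B"
  shows "card {k \<in> {1..n}. evaluation n Q F k \<noteq> 0} = n - card {P \<in> B. F P = 0}"
proof -
  have "Q ` {k \<in> {1..n}. evaluation n Q F k \<noteq> 0} = B - {P \<in> B. F P = 0}"
    unfolding bij_betw_imp_surj_on[OF assms, symmetric] by (auto simp: evaluation_def)
  then have "bij_betw Q {k \<in> {1..n}. evaluation n Q F k \<noteq> 0} (B - {P \<in> B. F P = 0})"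
    by (rule bij_betw_subset[OF assms, rotated]) blast
  then have "card {k \<in> {1..n}. evaluation n Q F k \<noteq> 0} = card (B - {P \<in> B. F P = 0})"
    by (rule bij_betw_same_card)
  moreover have "finite B" using bij_betw_finite[OF assms] by simp
  ultimately show ?thesis
    using bij_betw_same_card[OF assms] by (simp add: card_Diff_subset)
qed

lemma min_distance_evaluation_ge:
  assumes bij: "bij_betw Q {1..n} B" and "fun_vs.subspace V" "F\<^sub>0 \<in> V" "F\<^sub>0 \<notin> vanishing_on B"
    and zeros: "\<And>F. F \<in> V \<Longrightarrow> F \<notin> vanishing_on B \<Longrightarrow> card {P \<in> B. F P = 0} + d \<le> n"
  shows "d \<le> min_distance n (evaluation n Q ` V)"
proof (rule min_distance_ge)
  show "linear_code n (evaluation n Q ` V)" using assms(2) by (rule linear_code_evaluation_image)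
  show "evaluation n Q F\<^sub>0 \<in> evaluation n Q ` V" using assms(3) by (rule imageI)
  show "evaluation n Q F\<^sub>0 \<noteq> 0" using assms(4) by (simp add: evaluation_eq_0_iff[OF bij])
  fix w assume "w \<in> evaluation n Q ` V" "w \<noteq> 0"
  then obtain F where "F \<in> V" and w_eq: "w = evaluation n Q F" by blast
  moreover have "F \<notin> vanishing_on B" using \<open>w \<noteq> 0\<close> by (simp add: w_eq evaluation_eq_0_iff[OF bij])
  ultimately have "card {P \<in> B. F P = 0} + d \<le> n" by (intro zeros)
  then show "d \<le> card {k \<in> {1..n}. w k \<noteq> 0}"
    unfolding w_eq weight_evaluation[OF bij] by linarith
qed

lemma recoversI:
  assumes "fun_vs.subspace C" and zero: "\<And>w. w \<in> C \<Longrightarrow> (\<And>k. k \<in> S \<Longrightarrow> w k = 0) \<Longrightarrow> w i = 0"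
  shows "recovers C i S"
proof -
  define extend where "extend r = (SOME c. c \<in> C \<and> restrict c S = r)" for r
  have "c i = extend (restrict c S) i" if "c \<in> C" for c
  proof -
    have extension: "extend (restrict c S) \<in> C" "restrict (extend (restrict c S)) S = restrict c S"
      using someI[of "\<lambda>c'. c' \<in> C \<and> restrict c' S = restrict c S" c] that
      by (simp_all add: extend_def)
    have "(c - extend (restrict c S)) k = 0" if "k \<in> S" for k
      using fun_cong[OF extension(2), of k] that by simp
    with fun_vs.subspace_diff[OF assms(1) that extension(1)]
    have "(c - extend (restrict c S)) i = 0" by (rule zero)
    then show ?thesis by simp
  qed
  then show ?thesis unfolding recovers_def by (intro exI[of _ "\<lambda>r. extend r i"]) blast
qed

section \<open>The space of polynomial functions\<close>

lemma eval_space_eq_span_image: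
  assumes "l \<ge> 0"
  shows "(eval_space p t l :: ('a::field point \<Rightarrow> 'a) set) =
    fun_vs.span ((\<lambda>(j, e). monomial t j e) ` ({..nat l} \<times> ({1..t} \<rightarrow>\<^sub>E {..p - 2})))"
proof -
  let ?J = "{..nat l} \<times> ({1..t} \<rightarrow>\<^sub>E {..p - 2})"
  have "{monomial t j e | j e. int j \<le> l \<and> (\<forall>i\<in>{1..t}. e i \<le> p - 2)}
      = (\<lambda>(j, e). monomial t j e :: 'a point \<Rightarrow> 'a) ` ?J" (is "?L = ?R")
  proof (intro subset_antisym subsetI)
    fix f assume "f \<in> ?L"
    then obtain j e where f_eq: "f = monomial t j e"
      and bounds: "int j \<le> l" "\<forall>i\<in>{1..t}. e i \<le> p - 2" by blast
    have "f = monomial t j (restrict e {1..t})" by (simp add: f_eq monomial_def)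
    moreover have "(j, restrict e {1..t}) \<in> ?J" using bounds by auto
    ultimately show "f \<in> ?R" by (intro image_eqI[of _ _ "(j, restrict e {1..t})"]) simp_all
  next
    fix f assume "f \<in> ?R"
    then obtain j e where "f = monomial t j e" "j \<le> nat l" "e \<in> {1..t} \<rightarrow>\<^sub>E {..p - 2}" by auto
    moreover from this have "int j \<le> l" using assms by linarith
    ultimately show "f \<in> ?L" by (auto simp: PiE_iff)
  qed
  then show ?thesis by (simp add: eval_space_def)
qed

lemma monomial_fun_upd:
  assumes "j \<in> {1..t}"
  shows "monomial t r e (x, y(j := z)) = x ^ r * (\<Prod>i\<in>{1..t} - {j}. y i ^ e i) * z ^ e j"
proof -
  have "(\<Prod>i=1..t. (y(j := z)) i ^ e i) = z ^ e j * (\<Prod>i\<in>{1..t} - {j}. (y(j := z)) i ^ e i)"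
    using prod.remove[OF finite_atLeastAtMost assms, of "\<lambda>i. (y(j := z)) i ^ e i"] by simp
  also have "(\<Prod>i\<in>{1..t} - {j}. (y(j := z)) i ^ e i) = (\<Prod>i\<in>{1..t} - {j}. y i ^ e i)"
    by (intro prod.cong) auto
  finally show ?thesis by (simp add: monomial_def mult_ac)
qed

lemma eval_space_restrict_to_line:
  fixes F :: "'a::field point \<Rightarrow> 'a"
  assumes "F \<in> eval_space p t l" "j \<in> {1..t}"
  shows "\<exists>f. degree f \<le> p - 2 \<and> (\<forall>z. F (x, y(j := z)) = poly f z)"
proof -
  let ?S = "{F :: 'a point \<Rightarrow> 'a. \<exists>f. degree f \<le> p - 2 \<and> (\<forall>z. F (x, y(j := z)) = poly f z)}"
  have "eval_space p t l \<subseteq> ?S"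
    unfolding eval_space_def
  proof (rule fun_vs.span_minimal)
    show "fun_vs.subspace ?S"
    proof (rule fun_vs.subspaceI)
      show "0 \<in> ?S" by (auto intro: exI[of _ 0])
      show "F + F' \<in> ?S" if "F \<in> ?S" "F' \<in> ?S" for F F'
        using that by (auto intro: degree_add_le exI[of _ "_ + _"])
      show "fun_scale c F \<in> ?S" if "F \<in> ?S" for c F
        using that
        by (auto simp: fun_scale_def intro: order_trans[OF degree_smult_le] exI[of _ "smult c _"])
    qed
    show "{monomial t r e | r e. int r \<le> l \<and> (\<forall>i\<in>{1..t}. e i \<le> p - 2)} \<subseteq> ?S"
    proof clarify
      fix r e assume "\<forall>i\<in>{1..t}. e i \<le> p - 2"
      let ?f = "monom (x ^ r * (\<Prod>i\<in>{1..t} - {j}. y i ^ e i)) (e j)"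
      have "degree ?f \<le> p - 2"
        using \<open>\<forall>i\<in>{1..t}. e i \<le> p - 2\<close> assms(2) by (auto intro: order_trans[OF degree_monom_le])
      moreover have "monomial t r e (x, y(j := z)) = poly ?f z" for z
        by (simp add: monomial_fun_upd[OF assms(2)] poly_monom)
      ultimately show "\<exists>f. degree f \<le> p - 2 \<and> (\<forall>z. monomial t r e (x, y(j := z)) = poly f z)"
        by blast
    qed
  qed
  then show ?thesis using assms(1) by blast
qed

lemma eval_space_subset_bounded_weight:
  assumes "t \<ge> 1"
  shows "(eval_space p t l :: ('a::field point \<Rightarrow> 'a) set) \<subseteq> fun_vs.span {monomial t j e | j e.
    p ^ t * j + p ^ (t - 1) * m * (\<Sum>i=1..t. e i) \<le> p ^ (t - 1) * (p * nat l + m * (t * (p - 2)))}"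
  unfolding eval_space_def
proof (intro fun_vs.span_mono subsetI, clarify)
  fix j e assume "int j \<le> l" and exponents: "\<forall>i\<in>{1..t}. e i \<le> p - 2"
  have "p ^ t = p ^ (t - 1) * p" using assms by (intro power_minus_mult[symmetric]) simp
  then have "p ^ t * j + p ^ (t - 1) * m * (\<Sum>i=1..t. e i)
      = p ^ (t - 1) * (p * j + m * (\<Sum>i=1..t. e i))"
    by (simp add: algebra_simps)
  moreover have "(\<Sum>i=1..t. e i) \<le> t * (p - 2)"
    using sum_bounded_above[of "{1..t}" e "p - 2"] exponents by simp
  moreover have "j \<le> nat l" using \<open>int j \<le> l\<close> by linarith
  ultimately have "p ^ t * j + p ^ (t - 1) * m * (\<Sum>i=1..t. e i)
      \<le> p ^ (t - 1) * (p * nat l + m * (t * (p - 2)))"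
    by (simp only: mult_le_mono add_mono order_refl)
  then show "\<exists>j' e'. monomial t j e = monomial t j' e' \<and>
      p ^ t * j' + p ^ (t - 1) * m * (\<Sum>i=1..t. e' i)
        \<le> p ^ (t - 1) * (p * nat l + m * (t * (p - 2)))"
    by blast
qed

section \<open>The code on the rational points\<close>

locale artin_schreier_code =
  fixes p h t n :: nat and a :: "nat \<Rightarrow> 'a::{field,finite}" and Q :: "nat \<Rightarrow> 'a point"
  assumes prime_p: "prime p"
    and fiber_size: "\<And>i x. i \<in> {1..t} \<Longrightarrow> card {y. y ^ p - y = a i * x ^ (p ^ h + 1)} = p"
    and bij_Q: "bij_betw Q {1..n} (affine_points p h t a)"
begin

abbreviation B :: "'a point set" where
  "B \<equiv> affine_points p h t a"

abbreviation code :: "int \<Rightarrow> (nat \<Rightarrow> 'a) set" where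
  "code l \<equiv> evaluation n Q ` eval_space p t l"

definition fiber :: "nat \<Rightarrow> 'a \<Rightarrow> 'a set" where
  "fiber i x = {y. y ^ p - y = a i * x ^ (p ^ h + 1)}"

lemma p_ge_2: "p \<ge> 2"
  using prime_p by (rule prime_ge_2_nat)

lemma card_fiber: "i \<in> {1..t} \<Longrightarrow> card (fiber i x) = p"
  unfolding fiber_def by (rule fiber_size)

lemma affine_points_eq_Sigma: "B = (SIGMA x:UNIV. PiE {1..t} (\<lambda>i. fiber i x))"
  by (auto simp: affine_points_def fiber_def PiE_iff extensional_def simp del: power_Suc power_add)

lemma mem_affine_points_iff:
  "P \<in> B \<longleftrightarrow> snd P \<in> extensional {1..t} \<and> (\<forall>i\<in>{1..t}. snd P i \<in> fiber i (fst P))"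
  unfolding affine_points_eq_Sigma by (cases P) (auto simp: PiE_iff)

lemma card_affine_points: "card B = p ^ t * CARD('a)"
proof -
  have "card (PiE {1..t} (\<lambda>i. fiber i x)) = p ^ t" for x
    unfolding card_PiE[OF finite_atLeastAtMost] by (simp add: card_fiber)
  then show ?thesis unfolding affine_points_eq_Sigma by (simp add: card_SigmaI finite_PiE)
qed

lemma length_eq: "n = p ^ t * CARD('a)"
  using bij_betw_same_card[OF bij_Q] by (simp add: card_affine_points)

lemma Q_in_B: "k \<in> {1..n} \<Longrightarrow> Q k \<in> B"
  using bij_Q by (rule bij_betwE[THEN bspec])

lemma Q_eq_iff: "k \<in> {1..n} \<Longrightarrow> k' \<in> {1..n} \<Longrightarrow> Q k = Q k' \<longleftrightarrow> k = k'"
  using bij_betw_imp_inj_on[OF bij_Q] by (rule inj_on_eq_iff)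

lemma snd_Q_extensional: "k \<in> {1..n} \<Longrightarrow> snd (Q k) \<in> extensional {1..t}"
  using Q_in_B by (simp add: mem_affine_points_iff)

lemma monomials_independent:
  assumes "d < CARD('a)"
    and zero: "\<And>P. P \<in> B \<Longrightarrow>
      (\<Sum>(j, e) \<in> {..d} \<times> ({1..t} \<rightarrow>\<^sub>E {..p - 2}). c (j, e) * monomial t j e P) = 0"
    and "j \<le> d" "e \<in> {1..t} \<rightarrow>\<^sub>E {..p - 2}"
  shows "c (j, e) = 0"
proof (rule poly_function_eq_0_imp_coeffs_eq_0[OF _ _ \<open>j \<le> d\<close>, of UNIV])
  fix x :: 'a
  show "(\<Sum>j\<le>d. c (j, e) * x ^ j) = 0"
  proof (rule polynomial_zero_on_grid_imp_coeffs_eq_0[where S = "\<lambda>i. fiber i x", OF _ _ _ assms(4)])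
    fix y assume "y \<in> PiE {1..t} (\<lambda>i. fiber i x)"
    then have "(x, y) \<in> B" by (simp add: affine_points_eq_Sigma del: PiE_iff)
    from zero[OF this]
    show "(\<Sum>e \<in> {1..t} \<rightarrow>\<^sub>E {..p - 2}. (\<Sum>j\<le>d. c (j, e) * x ^ j) * (\<Prod>i=1..t. y i ^ e i)) = 0"
      unfolding sum_distrib_right
      by (subst sum.swap) (simp add: monomial_def sum.cartesian_product[symmetric] mult.assoc)
  qed (use card_fiber p_ge_2 in auto)
qed (use assms(1) in simp)

theorem dim_code:
  assumes "0 \<le> l" "l < int CARD('a)"
  shows "int (fun_vs.dim (code l)) = (l + 1) * (int p - 1) ^ t"
proof -
  interpret evaluation: Vector_Spaces.linear fun_scale fun_scale "evaluation n Q"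
    by (rule linear_evaluation)
  define J where "J = {..nat l} \<times> ({1..t} \<rightarrow>\<^sub>E {..p - 2})"
  define mon :: "nat \<times> (nat \<Rightarrow> nat) \<Rightarrow> 'a point \<Rightarrow> 'a" where "mon = (\<lambda>(j, e). monomial t j e)"
  define g where "g = evaluation n Q \<circ> mon"
  have "finite J" by (auto simp: J_def intro: finite_PiE)
  have code_eq_span: "code l = fun_vs.span (g ` J)"
    unfolding eval_space_eq_span_image[OF assms(1)] J_def mon_def g_def image_comp[symmetric]
    by (rule evaluation.span_image[symmetric])
  have "\<forall>u\<in>J. c u = 0" if relation: "(\<Sum>u\<in>J. fun_scale (c u) (g u)) = 0" for c
  proof -
    have "evaluation n Q (\<Sum>u\<in>J. fun_scale (c u) (mon u)) = (\<Sum>u\<in>J. fun_scale (c u) (g u))"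
      by (simp add: g_def evaluation.sum evaluation.scale)
    also have "\<dots> = 0" by (rule relation)
    finally have "(\<Sum>u\<in>J. fun_scale (c u) (mon u)) \<in> vanishing_on B"
      unfolding evaluation_eq_0_iff[OF bij_Q] .
    then have "(\<Sum>(j, e)\<in>J. c (j, e) * monomial t j e P) = 0" if "P \<in> B" for P
      using that
      by (simp add: vanishing_on_def sum_fun_apply fun_scale_def mon_def case_prod_unfold)
    then have "c (j, e) = 0" if "(j, e) \<in> J" for j e
      using monomials_independent[of "nat l" c j e] that assms by (simp add: J_def nat_less_iff)
    then show ?thesis by auto
  qed
  note independent = fun_vs.independent_family[where g = g, OF \<open>finite J\<close> this]
  have "fun_vs.dim (fun_vs.span (g ` J)) = card J"
    using fun_vs.dim_span_eq_card_independent[OF independent(2)] card_image[OF independent(1)]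
    by simp
  moreover have "Suc (p - 2) = p - 1" using p_ge_2 by simp
  then have "card J = (nat l + 1) * (p - 1) ^ t"
    by (simp add: J_def card_cartesian_product card_PiE)
  ultimately show ?thesis
    unfolding code_eq_span using assms(1) p_ge_2 by (simp add: of_nat_diff algebra_simps)
qed

lemma Q_eq_if_in_fiber_recovery_set:
  assumes "i \<in> {1..n}" "j \<in> {1..t}" "k \<in> fiber_recovery_set n t Q i j"
  shows "Q k = (fst (Q i), (snd (Q i))(j := snd (Q k) j))"
proof -
  have "k \<in> {1..n}" and fst_eq: "fst (Q k) = fst (Q i)"
    and snd_eq: "\<forall>x\<in>{1..t} - {j}. snd (Q k) x = snd (Q i) x"
    using assms(3) by (auto simp: fiber_recovery_set_def)
  have "snd (Q k) = (snd (Q i))(j := snd (Q k) j)"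
  proof (rule extensionalityI)
    show "snd (Q k) \<in> extensional {1..t}" by (rule snd_Q_extensional[OF \<open>k \<in> {1..n}\<close>])
    show "(snd (Q i))(j := snd (Q k) j) \<in> extensional {1..t}"
      using snd_Q_extensional[OF assms(1)] assms(2) by (auto simp: extensional_def)
    show "snd (Q k) x = ((snd (Q i))(j := snd (Q k) j)) x" if "x \<in> {1..t}" for x
      using snd_eq that by simp
  qed
  with fst_eq show ?thesis by (metis prod.collapse)
qed

lemma disjoint_fiber_recovery_sets:
  assumes "i \<in> {1..n}"
  shows "disjoint_family_on (fiber_recovery_set n t Q i) {1..t}"
  unfolding disjoint_family_on_def
proof (intro ballI impI equals0I)
  fix j j' k
  assume "j \<in> {1..t}" "j' \<in> {1..t}" "j \<noteq> j'"
    and common: "k \<in> fiber_recovery_set n t Q i j \<inter> fiber_recovery_set n t Q i j'"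
  then have "snd (Q k) j = snd (Q i) j" by (simp add: fiber_recovery_set_def)
  then have "Q k = Q i"
    using Q_eq_if_in_fiber_recovery_set[OF assms \<open>j \<in> {1..t}\<close>, of k] common by simp
  then show False using common assms Q_eq_iff[of k i] by (simp add: fiber_recovery_set_def)
qed

lemma bij_betw_fiber_recovery_set:
  assumes position: "i \<in> {1..n}" and coordinate: "j \<in> {1..t}"
  shows "bij_betw (\<lambda>k. snd (Q k) j) (fiber_recovery_set n t Q i j)
    (fiber j (fst (Q i)) - {snd (Q i) j})"
proof (rule bij_betw_imageI)
  let ?R = "fiber_recovery_set n t Q i j"
  note Q_eq = Q_eq_if_in_fiber_recovery_set[OF position coordinate]
  have recovery_index: "k \<in> {1..n}" "k \<noteq> i" "fst (Q k) = fst (Q i)" if "k \<in> ?R" for k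
    using that by (auto simp: fiber_recovery_set_def)
  show "inj_on (\<lambda>k. snd (Q k) j) ?R"
    using Q_eq recovery_index(1) Q_eq_iff by (intro inj_onI) metis
  show "(\<lambda>k. snd (Q k) j) ` ?R = fiber j (fst (Q i)) - {snd (Q i) j}"
  proof (intro subset_antisym subsetI)
    fix y assume "y \<in> (\<lambda>k. snd (Q k) j) ` ?R"
    then obtain k where "k \<in> ?R" and y_eq: "y = snd (Q k) j" by blast
    note k_index = recovery_index[OF \<open>k \<in> ?R\<close>]
    have "y \<in> fiber j (fst (Q i))"
      using Q_in_B[OF k_index(1)] coordinate k_index(3) by (simp add: y_eq mem_affine_points_iff)
    moreover have "y \<noteq> snd (Q i) j"
      using Q_eq[OF \<open>k \<in> ?R\<close>] k_index(2) Q_eq_iff[OF k_index(1) position] y_eq by auto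
    ultimately show "y \<in> fiber j (fst (Q i)) - {snd (Q i) j}" by blast
  next
    fix y assume y_fiber: "y \<in> fiber j (fst (Q i)) - {snd (Q i) j}"
    have "(fst (Q i), (snd (Q i))(j := y)) \<in> B"
      using Q_in_B[OF position] y_fiber coordinate
      by (auto simp: mem_affine_points_iff extensional_def)
    then obtain k where "k \<in> {1..n}" and Q_k: "Q k = (fst (Q i), (snd (Q i))(j := y))"
      using bij_betw_imp_surj_on[OF bij_Q] by (metis imageE)
    have "snd (Q k) j = y" by (simp add: Q_k)
    then have "k \<noteq> i" using y_fiber by blast
    then have "k \<in> ?R" using \<open>k \<in> {1..n}\<close> by (simp add: Q_k fiber_recovery_set_def)
    with \<open>snd (Q k) j = y\<close> show "y \<in> (\<lambda>k. snd (Q k) j) ` ?R" by blast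
  qed
qed

lemma card_fiber_recovery_set:
  assumes "i \<in> {1..n}" "j \<in> {1..t}"
  shows "card (fiber_recovery_set n t Q i j) = p - 1"
proof -
  have "snd (Q i) j \<in> fiber j (fst (Q i))"
    using Q_in_B[OF assms(1)] assms(2) by (simp add: mem_affine_points_iff)
  then show ?thesis
    using bij_betw_same_card[OF bij_betw_fiber_recovery_set[OF assms]] card_fiber[OF assms(2)]
    by (simp add: card_Diff_singleton)
qed

lemma recovers_from_fiber_recovery_set:
  assumes position: "i \<in> {1..n}" and coordinate: "j \<in> {1..t}"
  shows "recovers (code l) i (fiber_recovery_set n t Q i j)"
proof (rule recoversI)
  let ?R = "fiber_recovery_set n t Q i j"
  show "fun_vs.subspace (code l)"
    using linear_code_evaluation_image[of "eval_space p t l" n Q]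
    by (simp add: linear_code_def eval_space_def)
  fix w assume "w \<in> code l" and zero: "\<And>k. k \<in> ?R \<Longrightarrow> w k = 0"
  then obtain F where "F \<in> eval_space p t l" and w_eq: "w = evaluation n Q F" by blast
  from eval_space_restrict_to_line[OF this(1) coordinate]
  obtain f where "degree f \<le> p - 2" and line: "\<And>z. F (fst (Q i), (snd (Q i))(j := z)) = poly f z"
    by blast
  have "poly f (snd (Q k) j) = 0" if "k \<in> ?R" for k
    using zero[OF that] line[of "snd (Q k) j"] that
      Q_eq_if_in_fiber_recovery_set[OF position coordinate that]
    by (simp add: w_eq evaluation_def fiber_recovery_set_def)
  moreover have "card ((\<lambda>k. snd (Q k) j) ` ?R) = p - 1"
    using card_image[OF bij_betw_imp_inj_on[OF bij_betw_fiber_recovery_set[OF position coordinate]]]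
      card_fiber_recovery_set[OF position coordinate] by simp
  ultimately have "f = 0"
    using \<open>degree f \<le> p - 2\<close> p_ge_2
    by (intro poly_eqI_degree[of "(\<lambda>k. snd (Q k) j) ` ?R"]) auto
  then show "w i = 0" using line[of "snd (Q i) j"] position by (simp add: w_eq evaluation_def)
qed

theorem recovery_system_code:
  "recovery_system n (code l) t (\<lambda>_. p - 1) (fiber_recovery_set n t Q)"
  unfolding recovery_system_def
proof (intro ballI conjI)
  fix i assume position: "i \<in> {1..n}"
  then show "disjoint_family_on (fiber_recovery_set n t Q i) {1..t}"
    by (rule disjoint_fiber_recovery_sets)
  fix j assume coordinate: "j \<in> {1..t}"
  show "fiber_recovery_set n t Q i j \<subseteq> {1..n} - {i}" by (auto simp: fiber_recovery_set_def)
  show "card (fiber_recovery_set n t Q i j) = p - 1"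
    using position coordinate by (rule card_fiber_recovery_set)
  show "recovers (code l) i (fiber_recovery_set n t Q i j)"
    using position coordinate by (rule recovers_from_fiber_recovery_set)
qed

lemma card_zeros_eval_space_le:
  assumes "F \<in> eval_space p t l" "F \<notin> vanishing_on B"
    and "t \<ge> 1" "h \<ge> 1" "CARD('a) = p ^ r" "lin_indep_over prime_subfield {1..t} a"
  shows "card {P \<in> B. F P = 0} \<le> p ^ (t - 1) * (p * nat l + (p ^ h + 1) * (t * (p - 2)))"
proof (rule card_zeros_le_weight[OF prime_p assms(5) _ assms(6) _ _ _ assms(2)])
  show "\<not> p dvd p ^ h + 1"
    using assms(4) p_ge_2 dvd_add_right_iff[of p "p ^ h" 1] by (simp add: dvd_power)
  show "F \<in> fun_vs.span {monomial t j e | j e.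
      p ^ t * j + p ^ (t - 1) * (p ^ h + 1) * (\<Sum>i=1..t. e i)
      \<le> p ^ (t - 1) * (p * nat l + (p ^ h + 1) * (t * (p - 2)))}"
    using eval_space_subset_bounded_weight[OF assms(3)] assms(1) by (rule subsetD)
  show "finite {P \<in> B. F P = 0}" using bij_betw_finite[OF bij_Q] by simp
qed (auto simp: vanishing_on_def mem_affine_points_iff fiber_def)

theorem min_distance_code:
  assumes "0 \<le> l" "t \<ge> 1" "h \<ge> 1" "CARD('a) = p ^ r" "lin_indep_over prime_subfield {1..t} a"
    and "p ^ (t - 1) * (p * nat l + (p ^ h + 1) * (t * (p - 2))) + d \<le> n" "d > 0"
  shows "d \<le> min_distance n (code l)"
proof (rule min_distance_evaluation_ge[OF bij_Q])
  show "fun_vs.subspace (eval_space p t l :: ('a point \<Rightarrow> 'a) set)" by (simp add: eval_space_def)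
  show "monomial t 0 (\<lambda>_. 0) \<in> eval_space p t l"
    unfolding eval_space_def using assms(1)
    by (intro fun_vs.span_base CollectI exI[of _ 0] exI[of _ "\<lambda>_. 0"]) simp
  have "Q 1 \<in> B" using Q_in_B assms(6,7) by simp
  moreover have "monomial t 0 (\<lambda>_. 0) (Q 1) = 1" by (simp add: monomial_def case_prod_unfold)
  ultimately show "monomial t 0 (\<lambda>_. 0) \<notin> vanishing_on B" by (force simp: vanishing_on_def)
  show "card {P \<in> B. F P = 0} + d \<le> n" if "F \<in> eval_space p t l" "F \<notin> vanishing_on B" for F
    using card_zeros_eval_space_le[OF that assms(2-5)] assms(6) by linarith
qed

end

lemma degree_bound_in_range:
  fixes p h t :: nat and l :: int
  assumes "2 \<le> p" "1 \<le> h" "1 \<le> t" "t \<le> h"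
    and l_eq: "l = int (p ^ (2 * h)) - int t * int p ^ h + 2 * int t * int p ^ (h - 1) - int t"
  shows "0 \<le> l" "l < int (p ^ (2 * h))"
proof -
  have "t \<le> p ^ h" using assms(1,4) less_exp[of h] power_mono[of 2 p h] by linarith
  then have "int t * int p ^ h \<le> int p ^ h * int p ^ h" by (intro mult_right_mono) simp_all
  moreover have "1 \<le> int p ^ (h - 1)" using assms(1) by (intro one_le_power) simp
  then have "int t * 1 \<le> int t * (2 * int p ^ (h - 1))" by (intro mult_left_mono) simp_all
  moreover have "int (p ^ (2 * h)) = int p ^ h * int p ^ h"
    by (simp only: mult_2 power_add of_nat_mult of_nat_power)
  ultimately show "0 \<le> l" unfolding l_eq by (simp add: algebra_simps)
  have "int p ^ h = int p * int p ^ (h - 1)" using assms(2) by (cases h) auto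
  then have "2 * int p ^ (h - 1) \<le> int p ^ h" using assms(1) by (simp add: mult_right_mono)
  then have "int t * (2 * int p ^ (h - 1)) \<le> int t * int p ^ h" by (intro mult_left_mono) simp_all
  moreover have "0 < int t" using assms(3) by simp
  ultimately show "l < int (p ^ (2 * h))" unfolding l_eq by linarith
qed

lemma max_weight_add_distance_eq_length:
  fixes p h t :: nat and l :: int
  assumes "2 \<le> p" "1 \<le> h" "1 \<le> t" "0 \<le> l"
    and l_eq: "l = int (p ^ (2 * h)) - int t * int p ^ h + 2 * int t * int p ^ (h - 1) - int t"
  shows "p ^ (t - 1) * (p * nat l + (p ^ h + 1) * (t * (p - 2))) + 2 * t * p ^ (t - 1)
    = p ^ t * p ^ (2 * h)"
proof -
  have "int p ^ h = int p * int p ^ (h - 1)" using assms(2) by (cases h) auto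
  then have "int (p * nat l + (p ^ h + 1) * (t * (p - 2)) + 2 * t) = int (p * p ^ (2 * h))"
    using assms(1,4) unfolding of_nat_add of_nat_mult
    by (simp add: of_nat_diff l_eq algebra_simps)
  then have "p * nat l + (p ^ h + 1) * (t * (p - 2)) + 2 * t = p * p ^ (2 * h)"
    by (simp only: of_nat_eq_iff)
  moreover have "p ^ t = p ^ (t - 1) * p" using assms(3) by (intro power_minus_mult[symmetric]) simp
  ultimately show ?thesis by (metis distrib_left mult.assoc mult.commute)
qed

theorem theorem7p1:
  fixes p h t n :: nat
    and l :: int
    and a :: "nat \<Rightarrow> 'a::{field,finite}"
    and Q :: "nat \<Rightarrow> 'a point"
    and C :: "(nat \<Rightarrow> 'a) set"
  assumes "prime p" and "h \<ge> 1"
    and "CARD('a) = p ^ (2 * h)"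
    and "basis_over prime_subfield {z :: 'a. z ^ (p ^ h) + z = 0} {1..h} a"
    and "1 \<le> t" and "t \<le> h"
    and "bij_betw Q {1..n} (affine_points p h t a)"
    and "l = int (p ^ (2 * h)) - int t * int p ^ h + 2 * int t * int p ^ (h - 1) - int t"
    and "C = evaluation n Q ` eval_space p t l"
  shows "linear_code n C
    \<and> n = p ^ t * p ^ (2 * h)
    \<and> int (fun_vs.dim C) =
          (int (p ^ (2 * h)) - int t * int p ^ h + 2 * int t * int p ^ (h - 1) - int t + 1)
            * (int p - 1) ^ t
    \<and> min_distance n C \<ge> 2 * t * p ^ (t - 1)
    \<and> has_availability_locality n C t (\<lambda>_. p - 1)
    \<and> recovery_system n C t (\<lambda>_. p - 1) (fiber_recovery_set n t Q)"
proof -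
  have root: "a i ^ (p ^ h) + a i = 0" if "i \<in> {1..t}" for i
    using basis_over_imp_mem[OF assms(4), of i] that assms(6) by simp
  then have "card {y. y ^ p - y = a i * x ^ (p ^ h + 1)} = p" if "i \<in> {1..t}" for i x
    using assms(1-3) that by (intro card_artin_schreier_fiber_norm)
  then interpret artin_schreier_code p h t n a Q
    using assms(1,7) by (intro artin_schreier_code.intro)
  have indep: "lin_indep_over prime_subfield {1..t} a"
    using lin_indep_over_subset[OF basis_over_imp_lin_indep_over[OF assms(4)]] assms(6) by simp
  note l_range = degree_bound_in_range[OF p_ge_2 assms(2,5,6,8)]
  note weight = max_weight_add_distance_eq_length[OF p_ge_2 assms(2,5) l_range(1) assms(8)]
  have length: "n = p ^ t * p ^ (2 * h)" using length_eq assms(3) by simp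
  have "linear_code n C"
    unfolding assms(9) by (rule linear_code_evaluation_image) (simp add: eval_space_def)
  moreover have "int (fun_vs.dim C) = (l + 1) * (int p - 1) ^ t"
    unfolding assms(9) using l_range assms(3) by (intro dim_code) simp_all
  moreover have "2 * t * p ^ (t - 1) \<le> min_distance n C"
    unfolding assms(9) using l_range(1) assms(5,2,3) indep
    by (rule min_distance_code) (use weight length assms(5) p_ge_2 in simp_all)
  moreover have "recovery_system n C t (\<lambda>_. p - 1) (fiber_recovery_set n t Q)"
    unfolding assms(9) by (rule recovery_system_code)
  ultimately show ?thesis using length unfolding has_availability_locality_def assms(8) by blast
qed

end
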